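(* Let $\mathcal L=(K,\mathsf X,\{F_i\}_{i\in\mathsf X})$ be a post-critically finite self-similar structure, with associated surjection $\pi$, such that the induced shift map $\mathsf s:K\to K$, $\mathsf s\circ\pi=\pi\circ\sigma$, is well-defined, and let $G_{\mathcal L}$ be the contracting group constructed from $\mathcal L$ (as defined in the context). Then the limit space $\mathcal J_{G_{\mathcal L}}$ of $G_{\mathcal L}$ has a self-similar structure $\mathcal L'=(\mathcal J_{G_{\mathcal L}},\mathsf X,\{F_i'\}_{i\in\mathsf X})$ (with associated surjection the quotient map $p:\mathsf X^{-\omega}\to\mathcal J_{G_{\mathcal L}}$). Moreover, $\mathcal L'$ is isomorphic to $\mathcal L$.
   Context: Let $\mathsf X$ be a finite set (the alphabet), with a fixed total order. $\mathsf X^*$ is the set of finite words $x_n\ldots x_2x_1$ over $\mathsf X$ (including the empty word $\varnothing$), a rooted tree with root $\varnothing$ in which $w$ is joined to $wx$ for $x\in\mathsf X$. $\mathsf X^{-\omega}$ is the set of left-infinite words $\ldots x_2x_1$ with the product topology ($\mathsf X$ discrete), and $\sigma(\ldots x_2x_1)=\ldots x_3x_2$ is the shift. A self-similar structure on a compact metrizable space $K$ is a system $\mathcal L=(K,\mathsf X,\{F_i\}_{i\in\mathsf X})$ of continuous injections $F_i:K\to K$ for which there is a continuous surjection $\pi:\mathsf X^{-\omega}\to K$ with $F_i\circ\pi=\pi\circ i$ for all $i\in\mathsf X$, where $i(\ldots x_2x_1)=\ldots x_2x_1i$; $\pi$ is unique and is called the associated surjection. Put $K_i=F_i(K)$. The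 critical set is $\mathcal C=\pi^{-1}\bigl(\bigcup_{i\ne j}(K_i\cap K_j)\bigr)$ and the post-critical set is $\mathcal P=\bigcup_{n\ge1}\sigma^n(\mathcal C)$. $\mathcal L$ is post-critically finite if $\mathcal P$ is finite. Two self-similar structures $(K_j,\mathsf X_j,\{F^{(j)}_i\})$, $j=1,2$, with surjections $\pi_j$, are isomorphic if there is a bijection $\rho:\mathsf X_1\to\mathsf X_2$ such that $\pi_2\circ\iota_\rho\circ\pi_1^{-1}$ is a well-defined homeomorphism between $K_1$ and $K_2$, where $\iota_\rho(\ldots x_2x_1)=\ldots\rho(x_2)\rho(x_1)$. For $g\in\operatorname{Aut}\mathsf X^*$ (rooted tree automorphisms) and $v\in\mathsf X^*$ the restriction $g|_v$ is defined by $g(vw)=g(v)\,g|_v(w)$ for all $w$ (words are read from left to right); $g\cdot x=y\cdot h$ means $g(x)=y$ and $g|_x=h$. A self-similar action $(G,\mathsf X)$ is a faithful action of a group $G$ on $\mathsf X^*$ by automorphisms with $g|_x\in G$ for all $g\in G,x\in\mathsf X$. It is contracting if there is a finite set $\mathcal N\subset G$ such that for every $g\in G$ there is $k\in\mathbb N$ with $g|_w\in\mathcal N$ whenever $|w|\ge k$. Words $\ldots x_2x_1,\ldots y_2y_1\in\mathsf X^{-\omega}$ are asymptotically equivalent if there is a sequence $(g_k)_{k\ge1}$ in $G$, taking only finitely many values, with $g_k(x_k\ldots x_1)=y_k\ldots y_1$ for all $k$. The limit space $\mathcal J_G$ is the quotient space of $\mathsf X^{-\omega}$ by this relation, with quotient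 map $p$. Construction of $G_{\mathcal L}$. For a non-empty word $z$ put $\overline z=\ldots zzz$, and for non-empty $S_j\subset\mathsf X$ put $\overline zS_n\ldots S_2S_1=\{\overline z\zeta_n\ldots\zeta_2\zeta_1:\zeta_j\in S_j\}$. Under the assumptions on $\mathcal L$, $\pi(\mathcal C)$ is finite and for each $\alpha\in\pi(\mathcal C)$ one has (uniquely) $\pi^{-1}(\alpha)=\overline zS_n\ldots S_2S_1$ with $n\ge1$, $|S_1|\ge2$, $z=z_k\ldots z_1$ not of the form $v^r$ with $r>1$, and $z_k\notin S_n$. If $S=\{s_1<\dots<s_m\}$, let $\sigma_S$ be the cyclic permutation $(s_1s_2\ldots s_m)$ of $\mathsf X$. For each such $\alpha$ define automorphisms $g_{\alpha,1},\ldots,g_{\alpha,n+k-1}$ of $\mathsf X^*$ recursively, with the convention $g_{\alpha,0}=1$: - for $1\le j\le n-1$: $g_{\alpha,j}\cdot x=\sigma_{S_j}(x)\cdot g_{\alpha,j-1}$ if $x\in S_j$, and $x\cdot1$ otherwise; - for $j=n$: $g_{\alpha,n}\cdot x=\sigma_{S_n}(x)\cdot g_{\alpha,n-1}$ if $x\in S_n$, $\;x\cdot g_{\alpha,n+k-1}$ if $x=z_k$, and $x\cdot1$ otherwise; - for $n+1\le j\le n+k-1$: $g_{\alpha,j}\cdot x=x\cdot g_{\alpha,j-1}$ if $x=z_{j-n}$, and $x\cdot1$ otherwise. $G_{\mathcal L}$ is the subgroup of $\operatorname{Aut}\mathsf X^*$ generated by all $g_{\alpha,j}$, $\alpha\in\pi(\mathcal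 C)$; it is a contracting self-similar group. *)

theory Defs
  imports "HOL-Analysis.Analysis" "HOL-Algebra.Generated_Groups" "HOL-Combinatorics.Cycles"
begin

(* The alphabet is a type 'x, of class finite (and linorder where its total order is used).
   A left-infinite word ... x_2 x_1 is the function w :: nat => 'x with w m = x_(m+1).
   A finite word x_n ... x_1 is the list [x_n, ..., x_1], so the head is the letter next to the
   root and the subscripts of the letters count from the right end of the list, starting at 1. *)

section \<open>Words\<close>

definition letter :: "'a list \<Rightarrow> nat \<Rightarrow> 'a" where
  "letter v j = v ! (length v - j)"

definition shift :: "(nat \<Rightarrow> 'x) \<Rightarrow> (nat \<Rightarrow> 'x)" where
  "shift w = (\<lambda>m. w (Suc m))"

text \<open>The left-infinite word \<open>w v\<close>: the finite word \<open>v\<close> is attached to the right end of \<open>w\<close>.\<close>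

definition word_append :: "(nat \<Rightarrow> 'x) \<Rightarrow> 'x list \<Rightarrow> (nat \<Rightarrow> 'x)" where
  "word_append w v = (\<lambda>m. if m < length v then letter v (Suc m) else w (m - length v))"

text \<open>The finite word \<open>x\<^sub>k \<dots> x\<^sub>1\<close> at the right end of \<open>\<dots> x\<^sub>2 x\<^sub>1\<close>.\<close>

definition word_end :: "(nat \<Rightarrow> 'x) \<Rightarrow> nat \<Rightarrow> 'x list" where
  "word_end w k = rev (map w [0..<k])"

definition periodic_word :: "'x list \<Rightarrow> (nat \<Rightarrow> 'x)" where
  "periodic_word z = (\<lambda>m. letter z (Suc (m mod length z)))"

definition word_topology :: "(nat \<Rightarrow> 'x) topology" where
  "word_topology = product_topology (\<lambda>_. discrete_topology UNIV) UNIV"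


section \<open>Self-similar structures\<close>

definition associated_surjection ::
    "'k topology \<Rightarrow> ('x \<Rightarrow> 'k \<Rightarrow> 'k) \<Rightarrow> ((nat \<Rightarrow> 'x) \<Rightarrow> 'k) \<Rightarrow> bool" where
  "associated_surjection K F \<pi> \<longleftrightarrow>
     continuous_map word_topology K \<pi> \<and> range \<pi> = topspace K \<and>
     (\<forall>i w. F i (\<pi> w) = \<pi> (word_append w [i]))"

definition self_similar_structure :: "'k topology \<Rightarrow> ('x::finite \<Rightarrow> 'k \<Rightarrow> 'k) \<Rightarrow> bool" where
  "self_similar_structure K F \<longleftrightarrow>
     compact_space K \<and> metrizable_space K \<and>
     (\<forall>i. continuous_map K K (F i) \<and> inj_on (F i) (topspace K)) \<and>
     (\<exists>\<pi>. associated_surjection K F \<pi>)"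

definition critical_set ::
    "'k topology \<Rightarrow> ('x \<Rightarrow> 'k \<Rightarrow> 'k) \<Rightarrow> ((nat \<Rightarrow> 'x) \<Rightarrow> 'k) \<Rightarrow> (nat \<Rightarrow> 'x) set" where
  "critical_set K F \<pi> =
     \<pi> -` (\<Union>(i, j) \<in> {(i, j). i \<noteq> j}. F i ` topspace K \<inter> F j ` topspace K)"

definition post_critical_set ::
    "'k topology \<Rightarrow> ('x \<Rightarrow> 'k \<Rightarrow> 'k) \<Rightarrow> ((nat \<Rightarrow> 'x) \<Rightarrow> 'k) \<Rightarrow> (nat \<Rightarrow> 'x) set" where
  "post_critical_set K F \<pi> = (\<Union>n\<in>{1..}. (shift ^^ n) ` critical_set K F \<pi>)"

definition post_critically_finite ::
    "'k topology \<Rightarrow> ('x \<Rightarrow> 'k \<Rightarrow> 'k) \<Rightarrow> ((nat \<Rightarrow> 'x) \<Rightarrow> 'k) \<Rightarrow> bool" where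
  "post_critically_finite K F \<pi> \<longleftrightarrow> finite (post_critical_set K F \<pi>)"

definition induced_shift_well_defined :: "'k topology \<Rightarrow> ((nat \<Rightarrow> 'x) \<Rightarrow> 'k) \<Rightarrow> bool" where
  "induced_shift_well_defined K \<pi> \<longleftrightarrow>
     (\<exists>s. s ` topspace K \<subseteq> topspace K \<and> s \<circ> \<pi> = \<pi> \<circ> shift)"

text \<open>The associated surjections of self-similar structures are unique, so quantifying over them
  here only names them. The map \<open>h\<close> is \<open>\<pi>\<^sub>2 \<circ> \<iota>\<^sub>\<rho> \<circ> \<pi>\<^sub>1\<^sup>-\<^sup>1\<close>; the equation \<open>h \<circ> \<pi>\<^sub>1 = \<pi>\<^sub>2 \<circ> \<iota>\<^sub>\<rho>\<close>
  expresses that this is well defined.\<close>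

definition isomorphic_structures ::
    "'k topology \<Rightarrow> ('x \<Rightarrow> 'k \<Rightarrow> 'k) \<Rightarrow> 'l topology \<Rightarrow> ('y \<Rightarrow> 'l \<Rightarrow> 'l) \<Rightarrow> bool" where
  "isomorphic_structures K1 F1 K2 F2 \<longleftrightarrow>
     (\<exists>\<pi>1 \<pi>2. associated_surjection K1 F1 \<pi>1 \<and> associated_surjection K2 F2 \<pi>2 \<and>
       (\<exists>(\<rho> :: 'x \<Rightarrow> 'y) h. bij \<rho> \<and> homeomorphic_map K1 K2 h \<and>
          (\<forall>w. h (\<pi>1 w) = \<pi>2 (\<rho> \<circ> w))))"


section \<open>Automorphisms of the tree of words and the limit space\<close>

definition word_adjacent :: "'x list \<Rightarrow> 'x list \<Rightarrow> bool" where
  "word_adjacent u v \<longleftrightarrow> (\<exists>x. v = u @ [x] \<or> u = v @ [x])"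

definition tree_automorphism :: "('x list \<Rightarrow> 'x list) \<Rightarrow> bool" where
  "tree_automorphism g \<longleftrightarrow>
     bij g \<and> g [] = [] \<and> (\<forall>u v. word_adjacent (g u) (g v) \<longleftrightarrow> word_adjacent u v)"

definition Aut_words :: "('x list \<Rightarrow> 'x list) monoid" where
  "Aut_words = \<lparr>carrier = {g. tree_automorphism g}, mult = (\<circ>), one = id\<rparr>"

definition asymptotically_equivalent ::
    "('x list \<Rightarrow> 'x list) set \<Rightarrow> (nat \<Rightarrow> 'x) \<Rightarrow> (nat \<Rightarrow> 'x) \<Rightarrow> bool" where
  "asymptotically_equivalent G x y \<longleftrightarrow>
     (\<exists>g :: nat \<Rightarrow> 'x list \<Rightarrow> 'x list.
        (\<forall>k\<ge>1. g k \<in> G) \<and> finite (g ` {1..}) \<and> (\<forall>k\<ge>1. g k (word_end x k) = word_end y k))"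

definition quotient_topology :: "'a topology \<Rightarrow> ('a \<times> 'a) set \<Rightarrow> 'a set topology" where
  "quotient_topology T R =
     topology (\<lambda>U. U \<subseteq> topspace T // R \<and> openin T {x \<in> topspace T. R `` {x} \<in> U})"

lemma openin_quotient_topology:
  "openin (quotient_topology T R) U \<longleftrightarrow>
     U \<subseteq> topspace T // R \<and> openin T {x \<in> topspace T. R `` {x} \<in> U}"
proof -
  let ?P = "\<lambda>U. U \<subseteq> topspace T // R \<and> openin T {x \<in> topspace T. R `` {x} \<in> U}"
  have "istopology ?P"
    unfolding istopology_def
  proof (rule conjI; (intro allI impI)?)
    fix U V assume U: "?P U" and V: "?P V"
    have "{x \<in> topspace T. R `` {x} \<in> U \<inter> V}
        = {x \<in> topspace T. R `` {x} \<in> U} \<inter> {x \<in> topspace T. R `` {x} \<in> V}" by blast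
    moreover have "openin T ({x \<in> topspace T. R `` {x} \<in> U} \<inter> {x \<in> topspace T. R `` {x} \<in> V})"
      by (rule openin_Int[OF conjunct2[OF U] conjunct2[OF V]])
    ultimately have "openin T {x \<in> topspace T. R `` {x} \<in> U \<inter> V}" by (simp only:)
    moreover have "U \<inter> V \<subseteq> topspace T // R" by (rule le_infI1[OF conjunct1[OF U]])
    ultimately show "?P (U \<inter> V)" by (rule conjI[rotated])
  next
    fix \<K> assume K: "\<forall>U\<in>\<K>. ?P U"
    have "{x \<in> topspace T. R `` {x} \<in> \<Union>\<K>} = (\<Union>U\<in>\<K>. {x \<in> topspace T. R `` {x} \<in> U})" by blast
    moreover have "openin T (\<Union>U\<in>\<K>. {x \<in> topspace T. R `` {x} \<in> U})"
      by (rule openin_Union) (use K in fast)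
    ultimately have "openin T {x \<in> topspace T. R `` {x} \<in> \<Union>\<K>}" by (simp only:)
    moreover have "\<Union>\<K> \<subseteq> topspace T // R" by (rule Union_least) (use K in fast)
    ultimately show "?P (\<Union>\<K>)" by (rule conjI[rotated])
  qed
  then show ?thesis
    by (simp add: quotient_topology_def)
qed

lemma topspace_quotient_topology: "topspace (quotient_topology T R) = topspace T // R"
proof
  show "topspace (quotient_topology T R) \<subseteq> topspace T // R"
    using openin_quotient_topology[of T R "topspace (quotient_topology T R)"] by simp
  have "{x \<in> topspace T. R `` {x} \<in> topspace T // R} = topspace T"
    by (auto simp: quotient_def)
  then have "openin (quotient_topology T R) (topspace T // R)"
    by (simp add: openin_quotient_topology)
  then show "topspace T // R \<subseteq> topspace (quotient_topology T R)"
    by (rule openin_subset)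
qed

lemma quotient_map_quotient_topology:
  "quotient_map T (quotient_topology T R) (\<lambda>x. R `` {x})"
proof -
  have "(\<lambda>x. R `` {x}) ` topspace T = topspace T // R"
    by (auto simp: quotient_def)
  then show ?thesis
    by (simp add: quotient_map_def topspace_quotient_topology openin_quotient_topology)
qed

definition asymptotic_relation ::
    "('x list \<Rightarrow> 'x list) set \<Rightarrow> ((nat \<Rightarrow> 'x) \<times> (nat \<Rightarrow> 'x)) set" where
  "asymptotic_relation G = {(x, y). asymptotically_equivalent G x y}"

definition limit_space :: "('x list \<Rightarrow> 'x list) set \<Rightarrow> (nat \<Rightarrow> 'x) set topology" where
  "limit_space G = quotient_topology word_topology (asymptotic_relation G)"

definition limit_map :: "('x list \<Rightarrow> 'x list) set \<Rightarrow> (nat \<Rightarrow> 'x) \<Rightarrow> (nat \<Rightarrow> 'x) set" where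
  "limit_map G w = asymptotic_relation G `` {w}"


section \<open>The group of a self-similar structure\<close>

text \<open>The set \<open>z\<^sup>-\<^sup>\<omega> S\<^sub>n \<dots> S\<^sub>1\<close> of left-infinite words, where \<open>Ss = [S\<^sub>n, \<dots>, S\<^sub>1]\<close>.\<close>

definition eventually_periodic_words :: "'x list \<Rightarrow> 'x set list \<Rightarrow> (nat \<Rightarrow> 'x) set" where
  "eventually_periodic_words z Ss =
     {word_append (periodic_word z) \<zeta> |\<zeta>. list_all2 (\<in>) \<zeta> Ss}"

definition fiber_presentation ::
    "((nat \<Rightarrow> 'x) \<Rightarrow> 'k) \<Rightarrow> 'k \<Rightarrow> 'x list \<Rightarrow> 'x set list \<Rightarrow> bool" where
  "fiber_presentation \<pi> \<alpha> z Ss \<longleftrightarrow>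
     z \<noteq> [] \<and> Ss \<noteq> [] \<and> {} \<notin> set Ss \<and>
     \<pi> -` {\<alpha>} = eventually_periodic_words z Ss \<and>
     card (letter Ss 1) \<ge> 2 \<and>
     \<not> (\<exists>v r. r > 1 \<and> z = concat (replicate r v)) \<and>
     letter z (length z) \<notin> letter Ss (length Ss)"

definition cyclic_perm :: "'x::linorder set \<Rightarrow> 'x \<Rightarrow> 'x" where
  "cyclic_perm S = cycle_of_list (sorted_list_of_set S)"

text \<open>\<open>fiber_gen z Ss j\<close> is \<open>g\<^sub>\<alpha>\<^sub>,\<^sub>j\<close> for the point \<open>\<alpha>\<close> whose fiber is presented by \<open>z\<close> and \<open>Ss\<close>;
  \<open>g \<cdot> x = y \<cdot> h\<close> becomes \<open>g (x # w) = y # h w\<close>. Only \<open>j \<le> n + k - 1\<close> is meaningful, where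
  \<open>n = length Ss\<close> and \<open>k = length z\<close>.\<close>

fun fiber_gen :: "'x::linorder list \<Rightarrow> 'x set list \<Rightarrow> nat \<Rightarrow> 'x list \<Rightarrow> 'x list" where
  "fiber_gen z Ss 0 w = w"
| "fiber_gen z Ss (Suc i) [] = []"
| "fiber_gen z Ss (Suc i) (x # w) =
    (let n = length Ss; k = length z; j = Suc i in
     if j < n then
       (if x \<in> letter Ss j then cyclic_perm (letter Ss j) x # fiber_gen z Ss (j - 1) w
        else x # w)
     else if j = n then
       (if x \<in> letter Ss n then cyclic_perm (letter Ss n) x # fiber_gen z Ss (n - 1) w
        else if x = letter z k then x # fiber_gen z Ss (n + k - 1) w
        else x # w)
     else
       (if x = letter z (j - n) then x # fiber_gen z Ss (j - 1) w
        else x # w))"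

text \<open>For a post-critically finite structure whose induced shift is well defined, every
  \<open>\<alpha> \<in> \<pi> ` critical_set K F \<pi>\<close> has exactly one presentation \<open>(z, Ss)\<close>, so that ranging over
  all presentations contributes one family of generators for each \<open>\<alpha>\<close>.\<close>

definition structure_generators ::
    "'k topology \<Rightarrow> ('x::linorder \<Rightarrow> 'k \<Rightarrow> 'k) \<Rightarrow> ((nat \<Rightarrow> 'x) \<Rightarrow> 'k) \<Rightarrow> ('x list \<Rightarrow> 'x list) set" where
  "structure_generators K F \<pi> =
     {fiber_gen z Ss j |\<alpha> z Ss j.
        \<alpha> \<in> \<pi> ` critical_set K F \<pi> \<and> fiber_presentation \<pi> \<alpha> z Ss \<and>
        1 \<le> j \<and> j \<le> length Ss + length z - 1}"

definition structure_group ::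
    "'k topology \<Rightarrow> ('x::linorder \<Rightarrow> 'k \<Rightarrow> 'k) \<Rightarrow> ((nat \<Rightarrow> 'x) \<Rightarrow> 'k) \<Rightarrow> ('x list \<Rightarrow> 'x list) set" where
  "structure_group K F \<pi> = generate Aut_words (structure_generators K F \<pi>)"

end

theory Submission
  imports Defs
begin

text \<open>
  The limit space is the quotient of the space of words by asymptotic equivalence, and \<open>K\<close> is the
  quotient of the same compact space by the relation \<open>\<pi> u = \<pi> w\<close>. The theorem therefore follows once
  these two relations agree (\<open>asymptotically_equivalent_iff\<close>): the two quotients are then
  homeomorphic over the space of words, and the maps \<open>F\<^sub>i\<close> can be carried over to the limit space.

  Call \<open>i\<close> a digit of \<open>x \<in> K\<close> if \<open>x \<in> F\<^sub>i K\<close>. As the shift descends to a map \<open>s\<close> of \<open>K\<close>, the words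
  representing \<open>x\<close> are exactly those whose \<open>m\<close>-th letter is, for every \<open>m\<close>, a digit of \<open>(s ^^ m) x\<close>
  (\<open>pi_eq_iff\<close>). A point is critical if and only if it has at least two digits. Post-critical
  finiteness makes the orbit of such a point preperiodic and gives every periodic point a single
  digit, so that the fiber is \<open>z\<^sup>-\<^sup>\<omega> S\<^sub>n \<dots> S\<^sub>1\<close> where \<open>n\<close> is the preperiod, \<open>S\<^sub>n, \<dots>, S\<^sub>1\<close> are sets of
  digits, and \<open>z\<close> is read off along the cycle (\<open>fiber_presentation_exists\<close>).

  Suppose that \<open>\<pi> u = \<pi> w\<close>. For each \<open>m\<close> the generators belonging to \<open>(s ^^ m) x\<close> rotate all letters of
  an address of \<open>x\<close> from position \<open>m\<close> on within their digit sets, and they do so on all finite ends of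
  this address with finitely many automorphisms. The rotation at position \<open>m\<close> is transitive on the
  digits, so \<open>u\<close> can be turned into \<open>w\<close> letter by letter from the right, in finitely many steps because
  all but finitely many digit sets are singletons (\<open>asymptotically_equivalent_if_pi_eq\<close>).

  For the converse, the cell of a finite word \<open>v\<close> is the set of all \<open>\<pi> (a v)\<close>. A generator \<open>g\<close> only
  replaces digits by digits of the same point, so the cells of \<open>v\<close> and \<open>g v\<close> have a common point
  (\<open>pi_fiber_gen\<close>). Cells of long words are uniformly small by compactness, so the cells of \<open>v\<close> and
  \<open>g v\<close> are close to each other when \<open>v\<close> is long, first for generators and then for all elements of
  the group. Asymptotic equivalence involves finitely many elements only, hence it forces
  \<open>\<pi> u\<close> and \<open>\<pi> w\<close> to be arbitrarily close.
\<close>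


section \<open>Left-infinite words and their finite ends\<close>

lemma letter_rev_map: "m < n \<Longrightarrow> letter (rev (map f [0..<n])) (Suc m) = f m"
  by (simp add: letter_def rev_nth)

lemma word_append_append: "word_append w (u @ v) = word_append (word_append w u) v"
  by (auto simp: word_append_def letter_def nth_append fun_eq_iff add.commute[of "length u"]
      intro!: arg_cong[of _ _ "nth u"])

lemma word_append_Cons: "word_append w (x # v) = word_append (word_append w [x]) v"
  using word_append_append[of w "[x]" v] by simp

lemma word_append_Nil [simp]: "word_append w [] = w"
  by (simp add: word_append_def)

lemma word_append_single: "word_append w [x] = (\<lambda>m. case m of 0 \<Rightarrow> x | Suc m \<Rightarrow> w m)"
  by (auto simp: word_append_def letter_def fun_eq_iff split: nat.splits)

lemma shift_funpow: "(shift ^^ m) w = (\<lambda>i. w (m + i))"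
  by (induction m arbitrary: w) (simp_all add: funpow_Suc_right shift_def del: funpow.simps)

lemma shift_append_single: "shift (word_append w [x]) = w"
  by (simp add: word_append_single shift_def)

lemma word_append_shift: "word_append (shift w) [w 0] = w"
  by (auto simp: word_append_single shift_def fun_eq_iff split: nat.splits)

lemma length_word_end [simp]: "length (word_end w k) = k"
  by (simp add: word_end_def)

lemma word_end_0 [simp]: "word_end w 0 = []"
  by (simp add: word_end_def)

lemma word_end_Suc: "word_end w (Suc k) = w k # word_end w k"
  by (simp add: word_end_def)

lemma word_end_cong: "(\<And>m. m < k \<Longrightarrow> u m = w m) \<Longrightarrow> word_end u k = word_end w k"
  by (simp add: word_end_def)

lemma word_end_add: "word_end w (m + k) = word_end ((shift ^^ m) w) k @ word_end w m"
  by (induction k) (simp_all add: word_end_Suc shift_funpow)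

lemma word_append_word_end: "word_append ((shift ^^ k) w) (word_end w k) = w"
proof
  fix m show "word_append ((shift ^^ k) w) (word_end w k) m = w m"
    by (cases "m < k") (simp_all add: word_append_def shift_funpow word_end_def letter_rev_map)
qed

lemma periodic_word_add_length: "periodic_word z (length z + m) = periodic_word z m"
  by (simp add: periodic_word_def)

lemma shift_periodic_word: "(shift ^^ length z) (periodic_word z) = periodic_word z"
  by (simp add: shift_funpow periodic_word_add_length)

lemma word_append_periodic_word: "z \<noteq> [] \<Longrightarrow> word_append (periodic_word z) z = periodic_word z"
  by (auto simp: word_append_def fun_eq_iff periodic_word_def le_mod_geq)

text \<open>The equation \<open>w z = w\<close> determines \<open>w\<close> letter by letter, reading off \<open>z\<close> again and again.\<close>

lemma periodic_word_unique:
  assumes "z \<noteq> []" "word_append w z = w"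
  shows "w = periodic_word z"
proof
  fix m show "w m = periodic_word z m"
  proof (induction m rule: less_induct)
    case (less m)
    have eq: "w m = word_append w z m" "periodic_word z m = word_append (periodic_word z) z m"
      using assms word_append_periodic_word[of z] by simp_all
    show ?case
    proof (cases "m < length z")
      case True
      then show ?thesis using eq by (simp add: word_append_def)
    next
      case False
      moreover have "0 < length z" using assms by simp
      ultimately have "w (m - length z) = periodic_word z (m - length z)"
        by (intro less.IH) linarith
      then show ?thesis using eq False by (simp add: word_append_def)
    qed
  qed
qed

lemma periodic_word_replicate:
  assumes "v \<noteq> []" "0 < r"
  shows "periodic_word (concat (replicate r v)) = periodic_word v"
proof -
  have "word_append (periodic_word v) (concat (replicate r v)) = periodic_word v"
    by (induction r) (simp_all add: word_append_append word_append_periodic_word assms)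
  moreover have "concat (replicate r v) \<noteq> []"
    using assms by (cases r) auto
  ultimately show ?thesis by (metis periodic_word_unique)
qed

lemma eventually_periodic_words_iff:
  "w \<in> eventually_periodic_words z Ss \<longleftrightarrow>
     (\<forall>m<length Ss. w m \<in> letter Ss (Suc m)) \<and> (\<forall>m. w (length Ss + m) = periodic_word z m)"
  (is "_ \<longleftrightarrow> ?R")
proof
  assume "w \<in> eventually_periodic_words z Ss"
  then obtain \<zeta> where \<zeta>: "w = word_append (periodic_word z) \<zeta>" "list_all2 (\<in>) \<zeta> Ss"
    by (auto simp: eventually_periodic_words_def)
  then show ?R
    by (auto simp: word_append_def letter_def list_all2_conv_all_nth)
next
  assume R: ?R
  let ?n = "length Ss"
  have "(shift ^^ ?n) w = periodic_word z" using R by (auto simp: shift_funpow)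
  then have "w = word_append (periodic_word z) (word_end w ?n)"
    using word_append_word_end[of ?n w] by simp
  moreover have "list_all2 (\<in>) (word_end w ?n) Ss"
    unfolding list_all2_conv_all_nth
  proof (intro conjI allI impI)
    fix i assume "i < length (word_end w ?n)"
    then have i: "i < ?n" by simp
    then have "w (?n - Suc i) \<in> letter Ss (Suc (?n - Suc i))" using R by simp
    moreover have "?n - Suc (?n - Suc i) = i" using i by linarith
    ultimately show "word_end w ?n ! i \<in> Ss ! i"
      using i by (simp add: word_end_def rev_nth letter_def)
  qed simp
  ultimately show "w \<in> eventually_periodic_words z Ss"
    by (auto simp: eventually_periodic_words_def)
qed


section \<open>The topology of the space of words\<close>

lemma topspace_word_topology [simp]: "topspace word_topology = UNIV"
  by (simp add: word_topology_def PiE_def extensional_def)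

lemma compact_word_topology: "compact_space (word_topology :: (nat \<Rightarrow> 'x::finite) topology)"
  by (simp add: word_topology_def compact_space_product_topology compact_space_discrete_topology)

lemma openin_cylinder: "openin word_topology {u. \<forall>m<N. u m = w m}"
proof -
  have "{u. \<forall>m<N. u m = w m} = Pi\<^sub>E UNIV (\<lambda>m. if m < N then {w m} else UNIV)"
    by (auto simp: PiE_def Pi_def extensional_def split: if_splits)
  moreover have "finite {m. (if m < N then {w m} else UNIV) \<noteq> UNIV}"
    by (rule finite_subset[of _ "{..<N}"]) auto
  ultimately show ?thesis
    unfolding word_topology_def by (auto intro!: product_topology_basis)
qed

lemma openin_word_topology_contains_cylinder:
  assumes "openin word_topology U" "w \<in> U"
  shows "\<exists>N. {u. \<forall>m<N. u m = w m} \<subseteq> U"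
proof -
  obtain X where X: "w \<in> Pi\<^sub>E UNIV X" "finite {m. X m \<noteq> UNIV}" "Pi\<^sub>E UNIV X \<subseteq> U"
    using product_topology_open_contains_basis[OF assms[unfolded word_topology_def]] by auto
  then obtain N where N: "\<And>m. X m \<noteq> UNIV \<Longrightarrow> m < N"
    using finite_nat_set_iff_bounded by auto
  have "u \<in> Pi\<^sub>E UNIV X" if u: "\<forall>m<N. u m = w m" for u
  proof (intro PiE_I)
    fix m show "u m \<in> X m"
      using u X(1) N[of m] by (cases "X m = UNIV") (auto simp: PiE_iff)
  qed simp
  then have "{u. \<forall>m<N. u m = w m} \<subseteq> U" using X(3) by blast
  then show ?thesis ..
qed

text \<open>Since the space of words is compact, a continuous function varies little on every cylinder
  that fixes enough letters, uniformly in the cylinder.\<close>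

lemma (in Metric_space) uniformly_continuous_on_words:
  fixes f :: "(nat \<Rightarrow> 'x::finite) \<Rightarrow> 'a"
  assumes f: "continuous_map word_topology mtopology f" and "\<epsilon> > 0"
  shows "\<exists>N. \<forall>u w. (\<forall>m<N. u m = w m) \<longrightarrow> d (f u) (f w) < \<epsilon>"
proof -
  have fM: "f w \<in> M" for w
    using f by (auto simp: continuous_map_def)
  have "\<exists>N. \<forall>u. (\<forall>m<N. u m = w m) \<longrightarrow> d (f w) (f u) < \<epsilon> / 2" for w
  proof -
    let ?U = "{u. f u \<in> mball (f w) (\<epsilon> / 2)}"
    have "openin word_topology ?U"
      using openin_continuous_map_preimage[OF f openin_mball[of "f w" "\<epsilon> / 2"]]
      by (simp only: topspace_word_topology UNIV_I simp_thms)
    moreover have "w \<in> ?U" using fM \<open>\<epsilon> > 0\<close> by simp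
    ultimately obtain N where N: "{u. \<forall>m<N. u m = w m} \<subseteq> ?U"
      using openin_word_topology_contains_cylinder by blast
    have "d (f w) (f u) < \<epsilon> / 2" if "\<forall>m<N. u m = w m" for u
    proof -
      have "u \<in> ?U" by (rule subsetD[OF N]) (rule CollectI, rule that)
      then show ?thesis unfolding mem_Collect_eq in_mball by (elim conjE)
    qed
    then show ?thesis by blast
  qed
  then have "\<forall>w. \<exists>N. \<forall>u. (\<forall>m<N. u m = w m) \<longrightarrow> d (f w) (f u) < \<epsilon> / 2" ..
  from choice[OF this] obtain N where
    N: "\<forall>w u. (\<forall>m<N w. u m = w m) \<longrightarrow> d (f w) (f u) < \<epsilon> / 2" ..
  let ?C = "\<lambda>w. {u. \<forall>m<N w. u m = w m}"
  have "\<exists>\<F>. finite \<F> \<and> \<F> \<subseteq> range ?C \<and> topspace word_topology \<subseteq> \<Union>\<F>"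
    using compact_word_topology[where 'x = 'x, unfolded compact_space_alt, rule_format, of "range ?C"]
    by (auto simp: openin_cylinder)
  then obtain \<F> where \<F>: "finite \<F>" "\<F> \<subseteq> range ?C" "\<Union>\<F> = UNIV"
    by auto
  then obtain W where W: "finite W" "\<F> = ?C ` W"
    using finite_subset_image[OF \<F>(1,2)] by blast
  have "d (f u) (f w) < \<epsilon>" if uw: "\<forall>m < Max (N ` W). u m = w m" for u w
  proof -
    have "u \<in> \<Union>(?C ` W)" using \<F>(3) W(2) by blast
    then obtain c where c: "c \<in> W" "\<forall>m<N c. u m = c m" by blast
    have "N c \<le> Max (N ` W)" using c(1) W(1) by simp
    then have "\<forall>m<N c. w m = c m" using uw c(2) by (metis less_le_trans)
    then have "d (f c) (f u) < \<epsilon> / 2" "d (f c) (f w) < \<epsilon> / 2" using N c(2) by blast+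
    moreover have "d (f u) (f w) \<le> d (f c) (f u) + d (f c) (f w)"
      using triangle[of "f u" "f c" "f w"] fM commute by metis
    ultimately show ?thesis by linarith
  qed
  then show ?thesis by blast
qed


section \<open>Tree automorphisms\<close>

text \<open>The condition says that \<open>A\<close> is a self-similar set of maps: the wreath recursion of each
  member consists of a permutation \<open>p\<close> of the alphabet and of restrictions \<open>q x\<close> lying in \<open>A\<close>.
  Only the set as a whole can be treated by induction on the length of words.\<close>

definition self_similar_maps :: "('x list \<Rightarrow> 'x list) set \<Rightarrow> bool" where
  "self_similar_maps A \<longleftrightarrow>
     (\<forall>g\<in>A. g [] = [] \<and>
        (\<exists>p q. bij p \<and> (\<forall>x. q x \<in> A) \<and> (\<forall>x w. g (x # w) = p x # q x w)))"

lemma self_similar_mapsE: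
  assumes "self_similar_maps A" "g \<in> A"
  obtains p q where "g [] = []" "bij p" "\<And>x. q x \<in> A" "\<And>x w. g (x # w) = p x # q x w"
  using assms unfolding self_similar_maps_def by blast

lemma self_similar_maps_length:
  assumes A: "self_similar_maps A"
  shows "g \<in> A \<Longrightarrow> length (g v) = length v"
proof (induction v arbitrary: g)
  case Nil
  then show ?case using self_similar_mapsE[OF A] by metis
next
  case (Cons x v)
  then show ?case using self_similar_mapsE[OF A Cons.prems] by (metis length_Cons)
qed

lemma self_similar_maps_inj:
  assumes A: "self_similar_maps A"
  shows "g \<in> A \<Longrightarrow> g u = g v \<Longrightarrow> u = v"
proof (induction u arbitrary: g v)
  case Nil
  then show ?case using self_similar_maps_length[OF A] by (metis length_0_conv)
next
  case (Cons x u)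
  from Cons.prems(1) obtain p q where
    g: "g [] = []" "bij p" "\<And>x. q x \<in> A" "\<And>x w. g (x # w) = p x # q x w"
    using self_similar_mapsE[OF A] by metis
  show ?case
  proof (cases v)
    case Nil
    then show ?thesis using Cons.prems g by simp
  next
    case (Cons y w)
    then have "p x = p y" "q x u = q y w" using Cons.prems g by auto
    moreover from this have "x = y" using g(2) by (metis bij_is_inj inj_eq)
    ultimately show ?thesis using Cons.IH[OF g(3)] Cons by metis
  qed
qed

lemma self_similar_maps_surj:
  assumes A: "self_similar_maps A"
  shows "g \<in> A \<Longrightarrow> \<exists>u. g u = v"
proof (induction v arbitrary: g)
  case Nil
  then show ?case using self_similar_mapsE[OF A] by metis
next
  case (Cons y v)
  from Cons.prems(1) obtain p q where
    g: "g [] = []" "bij p" "\<And>x. q x \<in> A" "\<And>x w. g (x # w) = p x # q x w"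
    using self_similar_mapsE[OF A] by metis
  obtain x where x: "p x = y" using g(2) by (metis bij_pointE)
  obtain u where "q x u = v" using Cons.IH[OF g(3)] by metis
  then have "g (x # u) = y # v" using x g by simp
  then show ?case ..
qed

lemma self_similar_maps_butlast:
  assumes A: "self_similar_maps A"
  shows "g \<in> A \<Longrightarrow> butlast (g v) = g (butlast v)"
proof (induction v arbitrary: g)
  case Nil
  then show ?case using self_similar_mapsE[OF A] by (metis butlast.simps(1))
next
  case (Cons x v)
  from Cons.prems(1) obtain p q where
    g: "g [] = []" "bij p" "\<And>x. q x \<in> A" "\<And>x w. g (x # w) = p x # q x w"
    using self_similar_mapsE[OF A] by metis
  have "q x v = [] \<longleftrightarrow> v = []"
    using self_similar_maps_length[OF A g(3)] by (metis length_0_conv)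
  then show ?case using Cons.IH[OF g(3), of x] g by auto
qed

lemma word_adjacent_butlast:
  "word_adjacent u v \<longleftrightarrow> v \<noteq> [] \<and> u = butlast v \<or> u \<noteq> [] \<and> v = butlast u"
  by (metis append_butlast_last_id butlast_snoc snoc_eq_iff_butlast word_adjacent_def)

lemma self_similar_maps_tree_automorphism:
  assumes A: "self_similar_maps A" and g: "g \<in> A"
  shows "tree_automorphism g"
  unfolding tree_automorphism_def
proof (intro conjI allI)
  have inj: "g u = g v \<longleftrightarrow> u = v" for u v
    using self_similar_maps_inj[OF A g] by blast
  then show "bij g"
    using self_similar_maps_surj[OF A g] by (metis bij_def inj_def surj_def)
  show nil: "g [] = []"
    using self_similar_maps_length[OF A g] by (metis length_0_conv)
  fix u v
  show "word_adjacent (g u) (g v) \<longleftrightarrow> word_adjacent u v"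
    unfolding word_adjacent_butlast self_similar_maps_butlast[OF A g] inj
    using inj nil by metis
qed

lemma tree_automorphism_inv:
  assumes "tree_automorphism g"
  shows "tree_automorphism (inv_into UNIV g)"
proof -
  have b: "bij g" and adj: "word_adjacent (g u) (g v) \<longleftrightarrow> word_adjacent u v" for u v
    using assms by (auto simp: tree_automorphism_def)
  have "g (inv_into UNIV g u) = u" for u using b by (simp add: bij_is_surj surj_f_inv_f)
  then show ?thesis
    using assms b adj unfolding tree_automorphism_def
    by (metis bij_imp_bij_inv bij_inv_eq_iff)
qed

lemma m_inv_Aut_words:
  assumes "tree_automorphism g"
  shows "m_inv Aut_words g = inv_into UNIV g"
  unfolding m_inv_def
proof (rule the_equality)
  have b: "bij g" using assms by (simp add: tree_automorphism_def)
  show "inv_into UNIV g \<in> carrier Aut_words \<and> g \<otimes>\<^bsub>Aut_words\<^esub> inv_into UNIV g = \<one>\<^bsub>Aut_words\<^esub> \<and>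
      inv_into UNIV g \<otimes>\<^bsub>Aut_words\<^esub> g = \<one>\<^bsub>Aut_words\<^esub>"
    using b tree_automorphism_inv[OF assms]
    by (auto simp: Aut_words_def fun_eq_iff bij_is_inj bij_is_surj surj_f_inv_f inv_f_f)
  fix h assume "h \<in> carrier Aut_words \<and> g \<otimes>\<^bsub>Aut_words\<^esub> h = \<one>\<^bsub>Aut_words\<^esub> \<and>
      h \<otimes>\<^bsub>Aut_words\<^esub> g = \<one>\<^bsub>Aut_words\<^esub>"
  then show "h = inv_into UNIV g"
    by (metis Aut_words_def inv_unique_comp monoid.simps(1,2))
qed


section \<open>The generators attached to a fiber\<close>

lemma bij_cyclic_perm: "bij (cyclic_perm S)"
  by (simp add: cyclic_perm_def permutation_bijective permutation_of_cycle)

lemma cyclic_perm_outside: "finite S \<Longrightarrow> x \<notin> S \<Longrightarrow> cyclic_perm S x = x"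
  by (simp add: cyclic_perm_def id_outside_supp)

lemma cyclic_perm_in: "finite S \<Longrightarrow> x \<in> S \<Longrightarrow> cyclic_perm S x \<in> S"
  using permutes_in_image[OF cycle_permutes, of "sorted_list_of_set S" x]
  by (simp add: cyclic_perm_def)

lemma cyclic_perm_singleton: "cyclic_perm {a} = id"
  by (simp add: cyclic_perm_def)

lemma cyclic_perm_transitive:
  assumes "finite S" "x \<in> S" "y \<in> S"
  shows "\<exists>e. (cyclic_perm S ^^ e) x = y"
proof -
  let ?l = "sorted_list_of_set S"
  obtain i j where ij: "i < length ?l" "x = ?l ! i" "j < length ?l" "y = ?l ! j"
    using assms by (metis in_set_conv_nth set_sorted_list_of_set)
  let ?e = "length ?l - i + j"
  have "(cyclic_perm S ^^ ?e) x = map (cyclic_perm S ^^ ?e) ?l ! i"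
    using ij by simp
  also have "\<dots> = rotate ?e ?l ! i"
    by (simp add: cyclic_perm_def cyclic_rotation)
  also have "\<dots> = ?l ! ((?e + i) mod length ?l)"
    using ij by (simp add: nth_rotate)
  also have "?e + i = length ?l + j" using ij by simp
  finally show ?thesis using ij by auto
qed

lemma fiber_gen_Nil [simp]: "fiber_gen z Ss j [] = []"
  by (cases j) simp_all

lemma fiber_gen_pre:
  "0 < j \<Longrightarrow> j < length Ss \<Longrightarrow> fiber_gen z Ss j (x # w) =
     (if x \<in> letter Ss j then cyclic_perm (letter Ss j) x # fiber_gen z Ss (j - 1) w else x # w)"
  by (cases j) (simp_all add: Let_def)

lemma fiber_gen_turn:
  "Ss \<noteq> [] \<Longrightarrow> fiber_gen z Ss (length Ss) (x # w) =
     (if x \<in> letter Ss (length Ss)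
      then cyclic_perm (letter Ss (length Ss)) x # fiber_gen z Ss (length Ss - 1) w
      else if x = letter z (length z) then x # fiber_gen z Ss (length Ss + length z - 1) w
      else x # w)"
  by (cases "length Ss") (simp_all add: Let_def)

lemma fiber_gen_period:
  "length Ss < j \<Longrightarrow> fiber_gen z Ss j (x # w) =
     (if x = letter z (j - length Ss) then x # fiber_gen z Ss (j - 1) w else x # w)"
  by (cases j) (simp_all add: Let_def)

lemma self_similar_maps_fiber_gen:
  fixes Ss :: "'x::{finite,linorder} set list"
  assumes "Ss \<noteq> []"
  shows "self_similar_maps (range (fiber_gen z Ss))"
  unfolding self_similar_maps_def
proof (intro ballI conjI)
  fix g assume "g \<in> range (fiber_gen z Ss)"
  then obtain j where g: "g = fiber_gen z Ss j" by auto
  then show "g [] = []" by simp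
  let ?A = "range (fiber_gen z Ss)" and ?n = "length Ss" and ?g = "fiber_gen z Ss"
  consider "j = 0" | "0 < j" "j < ?n" | "j = ?n" | "?n < j" by linarith
  then show "\<exists>p q. bij p \<and> (\<forall>x. q x \<in> ?A) \<and> (\<forall>x w. g (x # w) = p x # q x w)"
  proof cases
    case 1
    then show ?thesis
      by (intro exI[of _ id] exI[of _ "\<lambda>_. ?g 0"]) (simp add: g)
  next
    case 2
    then show ?thesis
      by (intro exI[of _ "cyclic_perm (letter Ss j)"]
          exI[of _ "\<lambda>x. if x \<in> letter Ss j then ?g (j - 1) else ?g 0"])
        (simp add: g fiber_gen_pre bij_cyclic_perm cyclic_perm_outside)
  next
    case 3
    then show ?thesis
      by (intro exI[of _ "cyclic_perm (letter Ss j)"]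
          exI[of _ "\<lambda>x. if x \<in> letter Ss j then ?g (j - 1)
            else if x = letter z (length z) then ?g (?n + length z - 1) else ?g 0"])
        (simp add: g fiber_gen_turn[OF assms] bij_cyclic_perm cyclic_perm_outside)
  next
    case 4
    then show ?thesis
      by (intro exI[of _ id]
          exI[of _ "\<lambda>x. if x = letter z (j - ?n) then ?g (j - 1) else ?g 0"])
        (simp add: g fiber_gen_period)
  qed
qed

section \<open>Fibers of the associated surjection\<close>

lemma two_le_card_iff:
  assumes "finite A"
  shows "2 \<le> card A \<longleftrightarrow> (\<exists>a\<in>A. \<exists>b\<in>A. a \<noteq> b)"
proof -
  have "2 \<le> card A \<longleftrightarrow> \<not> card A \<le> Suc 0" by linarith
  then show ?thesis using card_le_Suc0_iff_eq[OF assms] by blast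
qed

locale shift_invariant_structure =
  fixes K :: "'k topology" and F :: "'x::{finite,linorder} \<Rightarrow> 'k \<Rightarrow> 'k"
    and \<pi> :: "(nat \<Rightarrow> 'x) \<Rightarrow> 'k" and s :: "'k \<Rightarrow> 'k"
  assumes metrizable: "metrizable_space K"
    and surjection: "associated_surjection K F \<pi>"
    and pcf: "post_critically_finite K F \<pi>"
    and s_pi: "s (\<pi> w) = \<pi> (shift w)"
begin

abbreviation G :: "('x list \<Rightarrow> 'x list) set" where
  "G \<equiv> structure_group K F \<pi>"

definition digits :: "'k \<Rightarrow> 'x set" where
  "digits x = {i. x \<in> F i ` topspace K}"

lemma continuous_pi: "continuous_map word_topology K \<pi>"
  and range_pi: "range \<pi> = topspace K"
  and F_pi: "F i (\<pi> w) = \<pi> (word_append w [i])"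
  using surjection by (auto simp: associated_surjection_def)

lemma pi_in: "\<pi> w \<in> topspace K"
  using range_pi by blast

lemma pi_onto: "x \<in> topspace K \<Longrightarrow> \<exists>w. \<pi> w = x"
  using range_pi by (metis rangeE)

lemma s_in: "x \<in> topspace K \<Longrightarrow> s x \<in> topspace K"
  using pi_onto s_pi pi_in by metis

lemma orbit_in: "x \<in> topspace K \<Longrightarrow> (s ^^ m) x \<in> topspace K"
  by (induction m) (simp_all add: s_in)

lemma orbit_add: "(s ^^ (a + b)) x = (s ^^ b) ((s ^^ a) x)"
  by (subst add.commute) (simp add: funpow_add)

lemma s_F: "x \<in> topspace K \<Longrightarrow> s (F i x) = x"
  using pi_onto F_pi s_pi shift_append_single by metis

lemma orbit_pi: "(s ^^ m) (\<pi> w) = \<pi> ((shift ^^ m) w)"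
  by (induction m) (simp_all add: s_pi)

lemma pi_append_cong: "\<pi> a = \<pi> b \<Longrightarrow> \<pi> (word_append a v) = \<pi> (word_append b v)"
proof (induction v arbitrary: a b)
  case (Cons x v)
  have "\<pi> (word_append a [x]) = \<pi> (word_append b [x])"
    using Cons.prems by (simp flip: F_pi)
  then show ?case using Cons.IH by (metis word_append_Cons)
qed simp

lemma digits_iff: "x \<in> topspace K \<Longrightarrow> i \<in> digits x \<longleftrightarrow> F i (s x) = x"
  using s_F s_in by (auto simp: digits_def) (metis image_eqI)

lemma pi_append_digit:
  "x \<in> topspace K \<Longrightarrow> i \<in> digits x \<Longrightarrow> \<pi> a = s x \<Longrightarrow> \<pi> (word_append a [i]) = x"
  using digits_iff by (simp flip: F_pi)

lemma digit_pi: "w m \<in> digits ((s ^^ m) (\<pi> w))"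
proof -
  have "word_append (shift ((shift ^^ m) w)) [w m] = (shift ^^ m) w"
    using word_append_shift[of "(shift ^^ m) w"] by (simp add: shift_funpow)
  then show ?thesis
    using digits_iff[OF pi_in] by (simp add: orbit_pi s_pi F_pi)
qed

lemma digits_nonempty: "x \<in> topspace K \<Longrightarrow> digits x \<noteq> {}"
  using pi_onto[of x] digit_pi[of _ 0] by auto

lemma pi_append_digits:
  "x \<in> topspace K \<Longrightarrow> (\<And>m. m < N \<Longrightarrow> w m \<in> digits ((s ^^ m) x)) \<Longrightarrow> \<pi> u = (s ^^ N) x \<Longrightarrow>
     \<pi> (word_append u (word_end w N)) = x"
proof (induction N arbitrary: u)
  case (Suc N)
  have "\<pi> (word_append u [w N]) = (s ^^ N) x"
    using Suc.prems by (intro pi_append_digit orbit_in) simp_all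
  then have "\<pi> (word_append (word_append u [w N]) (word_end w N)) = x"
    using Suc.prems by (intro Suc.IH) simp_all
  then show ?case
    by (metis word_append_Cons word_end_Suc)
qed simp

text \<open>A fiber is a product of sets of letters: once the shift descends to \<open>K\<close>, the \<open>m\<close>-th letter of
  an address of \<open>x\<close> can be chosen among the digits of \<open>(s ^^ m) x\<close> independently of the other
  letters. A word chosen in this way is a limit of addresses of \<open>x\<close>, hence an address of \<open>x\<close>.\<close>

lemma pi_eq_iff:
  assumes x: "x \<in> topspace K"
  shows "\<pi> w = x \<longleftrightarrow> (\<forall>m. w m \<in> digits ((s ^^ m) x))"
proof
  show "\<pi> w = x \<Longrightarrow> \<forall>m. w m \<in> digits ((s ^^ m) x)"
    using digit_pi by auto
  assume w: "\<forall>m. w m \<in> digits ((s ^^ m) x)"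
  show "\<pi> w = x"
  proof (rule ccontr)
    assume neq: "\<pi> w \<noteq> x"
    have "closedin K {x}"
      using metrizable_imp_Hausdorff_space[OF metrizable] x closedin_Hausdorff_singleton by metis
    then have "openin word_topology {u. \<pi> u \<in> topspace K - {x}}"
      using openin_continuous_map_preimage[OF continuous_pi, of "topspace K - {x}"]
      by (simp add: openin_diff)
    moreover have "w \<in> {u. \<pi> u \<in> topspace K - {x}}" using neq pi_in by simp
    ultimately have "\<exists>N. {u. \<forall>m<N. u m = w m} \<subseteq> {u. \<pi> u \<in> topspace K - {x}}"
      by (rule openin_word_topology_contains_cylinder)
    then obtain N where N: "{u. \<forall>m<N. u m = w m} \<subseteq> {u. \<pi> u \<in> topspace K - {x}}" ..
    obtain u where "\<pi> u = (s ^^ N) x" using pi_onto[OF orbit_in[OF x]] by metis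
    then have "\<pi> (word_append u (word_end w N)) = x"
      using pi_append_digits x w by blast
    moreover have "word_append u (word_end w N) m = w m" if "m < N" for m
      using that by (simp add: word_append_def word_end_def letter_rev_map)
    then have "word_append u (word_end w N) \<in> {u. \<forall>m<N. u m = w m}" by simp
    then have "\<pi> (word_append u (word_end w N)) \<noteq> x" using N by blast
    ultimately show False by contradiction
  qed
qed

lemma two_digits_iff: "2 \<le> card (digits x) \<longleftrightarrow> (\<exists>i j. i \<noteq> j \<and> i \<in> digits x \<and> j \<in> digits x)"
  by (auto simp: two_le_card_iff)

lemma critical_iff: "w \<in> critical_set K F \<pi> \<longleftrightarrow> 2 \<le> card (digits (\<pi> w))"
  unfolding two_digits_iff by (auto simp: critical_set_def digits_def)

lemma image_critical_iff:
  "x \<in> \<pi> ` critical_set K F \<pi> \<longleftrightarrow> x \<in> topspace K \<and> 2 \<le> card (digits x)"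
  using pi_onto pi_in critical_iff by (metis imageE imageI)

lemma digits_singleton:
  assumes "x \<in> topspace K" "\<not> 2 \<le> card (digits x)" "i \<in> digits x"
  shows "digits x = {i}"
  using assms unfolding two_digits_iff by auto


section \<open>Critical fibers are eventually periodic\<close>

lemma finite_critical_set: "finite (critical_set K F \<pi>)"
proof (rule finite_subset)
  let ?P = "post_critical_set K F \<pi>"
  show "critical_set K F \<pi> \<subseteq> (\<lambda>(w, i). word_append w [i]) ` (?P \<times> UNIV)"
  proof
    fix w assume "w \<in> critical_set K F \<pi>"
    then have "shift w \<in> ?P"
      unfolding post_critical_set_def by (intro UN_I[of 1]) auto
    then show "w \<in> (\<lambda>(w, i). word_append w [i]) ` (?P \<times> UNIV)"
      by (intro image_eqI[of _ _ "(shift w, w 0)"]) (simp_all add: word_append_shift)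
  qed
  show "finite ((\<lambda>(w, i). word_append w [i]) ` (?P \<times> UNIV))"
    using pcf by (simp add: post_critically_finite_def)
qed

text \<open>If a point of period \<open>k\<close> had two digits, then every \<open>k\<close>-th letter of its addresses could be
  chosen freely, so that its fiber, which is contained in the critical set, would be infinite.\<close>

lemma periodic_point_single_digit:
  assumes x: "x \<in> topspace K" and k: "0 < k" "(s ^^ k) x = x"
  shows "\<not> 2 \<le> card (digits x)"
proof
  assume two: "2 \<le> card (digits x)"
  obtain u where u: "\<pi> u = x" using pi_onto[OF x] by metis
  have "\<exists>d\<in>digits x. d \<noteq> a" for a
    using two unfolding two_digits_iff by metis
  then obtain e where e: "\<And>a. e a \<in> digits x" "\<And>a. e a \<noteq> a" by metis
  let ?f = "\<lambda>i. u(i * k := e (u (i * k)))"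
  have per: "(s ^^ (i * k)) x = x" for i
    using funpow_mod_eq[OF k(2), of "i * k"] by simp
  have "\<pi> (?f i) = x" for i
    using u e(1) per unfolding pi_eq_iff[OF x] by simp
  then have "range ?f \<subseteq> critical_set K F \<pi>"
    using two by (auto simp: critical_iff)
  moreover have "inj ?f"
  proof (rule injI)
    fix i j assume "?f i = ?f j"
    then have "?f i (i * k) = ?f j (i * k)" by metis
    then have "i * k = j * k" using e(2) by (auto split: if_splits)
    then show "i = j" using k by simp
  qed
  ultimately show False
    using finite_critical_set finite_imageD finite_subset infinite_UNIV_nat by metis
qed

lemma critical_point_preperiodic:
  assumes x: "x \<in> topspace K" "2 \<le> card (digits x)"
  shows "\<exists>n k. 0 < k \<and> (s ^^ (n + k)) x = (s ^^ n) x"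
proof -
  obtain w where w: "w \<in> critical_set K F \<pi>" "x = \<pi> w"
    using x image_critical_iff by blast
  have "range (\<lambda>m. (s ^^ Suc m) x) \<subseteq> \<pi> ` post_critical_set K F \<pi>"
  proof safe
    fix m
    have "(shift ^^ Suc m) w \<in> post_critical_set K F \<pi>"
      unfolding post_critical_set_def using w(1) by (intro UN_I[of "Suc m"]) auto
    then show "(s ^^ Suc m) x \<in> \<pi> ` post_critical_set K F \<pi>"
      unfolding w(2) orbit_pi by blast
  qed
  then have "finite (range (\<lambda>m. (s ^^ Suc m) x))"
    using pcf by (meson finite_imageI finite_subset post_critically_finite_def)
  then have "\<not> inj (\<lambda>m. (s ^^ Suc m) x)"
    using finite_imageD infinite_UNIV_nat by blast
  then obtain a b where ab: "a \<noteq> b" "(s ^^ Suc a) x = (s ^^ Suc b) x"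
    unfolding inj_def by blast
  obtain i j where "i < j" "(s ^^ Suc i) x = (s ^^ Suc j) x"
  proof (cases "a < b")
    case True
    then show ?thesis using that ab(2) by blast
  next
    case False
    then have "b < a" using ab(1) by simp
    then show ?thesis using that ab(2)[symmetric] by blast
  qed
  then have "0 < j - i \<and> (s ^^ (Suc i + (j - i))) x = (s ^^ Suc i) x" by simp
  then show ?thesis by blast
qed

text \<open>For the presentation of the fiber over a critical point, \<open>n\<close> has to be the preperiod and \<open>k\<close>
  the period of the point under \<open>s\<close>. Minimality of \<open>k\<close> makes the repeating word primitive, and
  minimality of \<open>n\<close> keeps its leftmost letter out of \<open>S\<^sub>n\<close>.\<close>

lemma fiber_presentation_exists:
  assumes x: "x \<in> topspace K" "2 \<le> card (digits x)"
  shows "\<exists>z Ss. fiber_presentation \<pi> x z Ss"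
proof -
  let ?x = "\<lambda>m. (s ^^ m) x"
  define n where "n = (LEAST n. \<exists>k>0. ?x (n + k) = ?x n)"
  have "\<exists>k>0. ?x (n + k) = ?x n"
    unfolding n_def by (rule LeastI_ex) (use critical_point_preperiodic[OF x] in blast)
  moreover define k where "k = (LEAST k. 0 < k \<and> ?x (n + k) = ?x n)"
  ultimately have k: "0 < k" "?x (n + k) = ?x n"
    using LeastI_ex[of "\<lambda>k. 0 < k \<and> ?x (n + k) = ?x n"] by auto
  have n_least: "?x (n' + k') \<noteq> ?x n'" if "n' < n" "0 < k'" for n' k'
    using not_less_Least[OF that(1)[unfolded n_def]] that(2) by blast
  have k_least: "?x (n + k') \<noteq> ?x n" if "k' < k" "0 < k'" for k'
    using not_less_Least[OF that(1)[unfolded k_def]] that(2) by blast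
  have in_K: "?x m \<in> topspace K" for m by (rule orbit_in[OF x(1)])
  have per: "(s ^^ k) (?x (n + m)) = ?x (n + m)" for m
  proof -
    have "(s ^^ k) (?x (n + m)) = (s ^^ m) (?x (n + k))"
      by (simp only: orbit_add[symmetric] ac_simps)
    also have "\<dots> = (s ^^ m) (?x n)" by (simp only: k(2))
    also have "\<dots> = ?x (n + m)" by (rule orbit_add[symmetric])
    finally show ?thesis .
  qed
  have per_mod: "?x (n + m mod k) = ?x (n + m)" for m
    using funpow_mod_eq[of k s "?x n" m] per[of 0] by (simp add: orbit_add[of n])
  have single: "\<not> 2 \<le> card (digits (?x (n + m)))" for m
    by (rule periodic_point_single_digit[OF in_K k(1) per])
  have "0 < n" using single[of 0] x(2) by (cases n) auto
  obtain u where u: "\<pi> u = x" using pi_onto[OF x(1)] by metis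
  have u_digit: "u m \<in> digits (?x m)" for m using digit_pi[of u m] u by simp
  have digits_tail: "digits (?x (n + m)) = {u (n + m)}" for m
    using digits_singleton[OF in_K single u_digit] .
  define Ss where "Ss = rev (map (\<lambda>m. digits (?x m)) [0..<n])"
  define z where "z = rev (map (\<lambda>m. u (n + m)) [0..<k])"
  have len: "length Ss = n" "length z = k" by (simp_all add: Ss_def z_def)
  have letter_Ss: "letter Ss (Suc m) = digits (?x m)" if "m < n" for m
    unfolding Ss_def using that by (rule letter_rev_map)
  have periodic_z: "periodic_word z m = u (n + m)" for m
  proof -
    have "periodic_word z m = u (n + m mod k)"
      using k(1) by (simp add: periodic_word_def len z_def letter_rev_map)
    then show ?thesis using digits_tail[of m] digits_tail[of "m mod k"] per_mod[of m] by simp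
  qed
  have fiber: "\<pi> -` {x} = eventually_periodic_words z Ss"
  proof -
    have split: "(\<forall>m. P m) \<longleftrightarrow> (\<forall>m<n. P m) \<and> (\<forall>m. P (n + m))" for P :: "nat \<Rightarrow> bool"
      by (metis le_Suc_ex not_less)
    have "\<pi> w = x \<longleftrightarrow> (\<forall>m<n. w m \<in> digits (?x m)) \<and> (\<forall>m. w (n + m) \<in> digits (?x (n + m)))" for w
      unfolding pi_eq_iff[OF x(1)] by (rule split)
    then show ?thesis
      by (simp add: set_eq_iff eventually_periodic_words_iff len letter_Ss digits_tail periodic_z)
  qed
  have primitive: "\<not> (\<exists>v r. r > 1 \<and> z = concat (replicate r v))"
  proof
    assume "\<exists>v r. r > 1 \<and> z = concat (replicate r v)"
    then obtain v r where vr: "r > 1" "z = concat (replicate r v)" by blast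
    have "v \<noteq> []" using vr k(1) len by auto
    have "k = r * length v" using vr len by (simp add: length_concat sum_list_replicate)
    then have shorter: "length v < k" "0 < length v"
      using vr(1) \<open>v \<noteq> []\<close> by simp_all
    have "?x n = \<pi> (periodic_word z)"
    proof -
      have "(shift ^^ n) u = periodic_word z" by (auto simp: shift_funpow periodic_z)
      then show ?thesis using u orbit_pi[of n u] by simp
    qed
    also have "periodic_word z = periodic_word v"
      unfolding vr(2) using \<open>v \<noteq> []\<close> vr(1) by (intro periodic_word_replicate) simp_all
    finally have xn: "?x n = \<pi> (periodic_word v)" .
    have "?x (n + length v) = (s ^^ length v) (?x n)"
      by (rule orbit_add)
    also have "\<dots> = ?x n"
      unfolding xn orbit_pi shift_periodic_word ..
    finally show False using k_least shorter by blast
  qed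
  have turn: "letter z (length z) \<notin> letter Ss (length Ss)"
  proof
    obtain n' k' where Suc: "n = Suc n'" "k = Suc k'" using \<open>0 < n\<close> k(1) by (metis gr0_conv_Suc)
    let ?d = "u (n + k')"
    assume "letter z (length z) \<in> letter Ss (length Ss)"
    then have "?d \<in> digits (?x n')"
      using letter_Ss[of n'] letter_rev_map[of k' k "\<lambda>m. u (n + m)"]
      by (simp add: len Suc z_def)
    \<comment> \<open>Then the points one step before \<open>?x n\<close> and one step before \<open>?x (n + k)\<close> coincide.\<close>
    then have "?x n' = F ?d (?x n)"
      using digits_iff[OF in_K, of ?d n'] by (simp add: Suc)
    also have "\<dots> = F ?d (s (?x (n + k')))"
      using k(2) by (simp add: Suc)
    also have "\<dots> = ?x (n + k')"
      using digits_iff[OF in_K, of ?d "n + k'"] u_digit by simp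
    also have "n + k' = n' + k" by (simp add: Suc)
    finally show False using n_least[of n' k] k(1) Suc by simp
  qed
  have "{} \<notin> set Ss" using digits_nonempty[OF in_K] by (auto simp: Ss_def)
  moreover have "card (letter Ss 1) \<ge> 2" using letter_Ss[of 0] \<open>0 < n\<close> x(2) by simp
  moreover have "z \<noteq> []" "Ss \<noteq> []" using len k(1) \<open>0 < n\<close> by auto
  ultimately have "fiber_presentation \<pi> x z Ss"
    unfolding fiber_presentation_def using fiber primitive turn by blast
  then show ?thesis by blast
qed

text \<open>Conversely every presentation of a fiber displays the digits along the orbit of its point.
  The point reached after \<open>n\<close> steps has a periodic word as its address, so it is periodic itself.\<close>

lemma fiber_presentation_digits:
  assumes x: "x \<in> topspace K" and pres: "fiber_presentation \<pi> x z Ss"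
  shows "m < length Ss \<Longrightarrow> letter Ss (Suc m) = digits ((s ^^ m) x)"
    and "digits ((s ^^ (length Ss + m)) x) = {periodic_word z m}"
    and "(s ^^ (length Ss + length z)) x = (s ^^ length Ss) x"
proof -
  let ?n = "length Ss"
  have fiber: "(\<forall>m. w m \<in> digits ((s ^^ m) x)) \<longleftrightarrow>
      (\<forall>m<?n. w m \<in> letter Ss (Suc m)) \<and> (\<forall>m. w (?n + m) = periodic_word z m)" for w
    using pres unfolding fiber_presentation_def
    by (metis eventually_periodic_words_iff pi_eq_iff[OF x] vimage_singleton_eq)
  obtain u where u: "\<pi> u = x" using pi_onto[OF x] by metis
  have u1: "u m \<in> digits ((s ^^ m) x)" for m using digit_pi[of u m] u by simp
  then have u2: "\<And>m. m < ?n \<Longrightarrow> u m \<in> letter Ss (Suc m)" "\<And>m. u (?n + m) = periodic_word z m"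
    using fiber by auto
  \<comment> \<open>Changing a single letter of \<open>u\<close> tests both descriptions of the fiber at one position.\<close>
  show "letter Ss (Suc m) = digits ((s ^^ m) x)" if m: "m < ?n" for m
  proof (intro equalityI subsetI)
    fix e assume "e \<in> letter Ss (Suc m)"
    then have "\<forall>i. (u(m := e)) i \<in> digits ((s ^^ i) x)"
      using u2 m by (subst fiber) auto
    then show "e \<in> digits ((s ^^ m) x)" by (metis fun_upd_same)
  next
    fix e assume "e \<in> digits ((s ^^ m) x)"
    then have "\<forall>i. (u(m := e)) i \<in> digits ((s ^^ i) x)" using u1 by auto
    then show "e \<in> letter Ss (Suc m)" using m unfolding fiber by (metis fun_upd_same)
  qed
  show "digits ((s ^^ (?n + m)) x) = {periodic_word z m}"
  proof -
    have "e = periodic_word z m" if "e \<in> digits ((s ^^ (?n + m)) x)" for e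
    proof -
      have "\<forall>i. (u(?n + m := e)) i \<in> digits ((s ^^ i) x)" using u1 that by auto
      then show ?thesis unfolding fiber by (metis fun_upd_same)
    qed
    moreover have "periodic_word z m \<in> digits ((s ^^ (?n + m)) x)"
      using u1[of "?n + m"] u2(2) by simp
    ultimately show ?thesis by blast
  qed
  have "(shift ^^ ?n) u = periodic_word z" using u2(2) by (auto simp: shift_funpow)
  then have xn: "(s ^^ ?n) x = \<pi> (periodic_word z)" using orbit_pi[of ?n u] u by simp
  have "(s ^^ (?n + length z)) x = (s ^^ length z) ((s ^^ ?n) x)"
    by (rule orbit_add)
  also have "\<dots> = (s ^^ ?n) x" unfolding xn orbit_pi shift_periodic_word ..
  finally show "(s ^^ (?n + length z)) x = (s ^^ ?n) x" .
qed

lemma eventually_single_digit: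
  assumes x: "x \<in> topspace K"
  shows "\<exists>N. \<forall>m\<ge>N. \<not> 2 \<le> card (digits ((s ^^ m) x))"
proof (cases "\<exists>m. 2 \<le> card (digits ((s ^^ m) x))")
  case True
  then obtain i where i: "2 \<le> card (digits ((s ^^ i) x))" ..
  note in_K = orbit_in[OF x, of i]
  obtain z Ss where "fiber_presentation \<pi> ((s ^^ i) x) z Ss"
    using fiber_presentation_exists[OF in_K i] by blast
  note tail = fiber_presentation_digits(2)[OF in_K this]
  have "\<not> 2 \<le> card (digits ((s ^^ m) x))" if "m \<ge> length Ss + i" for m
  proof -
    define l where "l = m - (length Ss + i)"
    have "m = i + (length Ss + l)" using that by (simp add: l_def)
    then have "(s ^^ m) x = (s ^^ (length Ss + l)) ((s ^^ i) x)"
      by (simp only: orbit_add[of i])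
    then show ?thesis using tail[of l] by simp
  qed
  then show ?thesis by blast
qed blast


section \<open>Words with the same image are asymptotically equivalent\<close>

lemma id_in_G: "id \<in> G"
  using generate.one[of Aut_words] by (simp add: structure_group_def Aut_words_def)

lemma comp_in_G: "g \<in> G \<Longrightarrow> h \<in> G \<Longrightarrow> g \<circ> h \<in> G"
  using generate.eng[of g Aut_words _ h] by (simp add: structure_group_def Aut_words_def)

lemma fiber_gen_in_G:
  assumes "x \<in> topspace K" "2 \<le> card (digits x)" "fiber_presentation \<pi> x z Ss"
    and "1 \<le> j" "j \<le> length Ss + length z - 1"
  shows "fiber_gen z Ss j \<in> G"
proof -
  have "fiber_gen z Ss j \<in> structure_generators K F \<pi>"
    unfolding structure_generators_def using assms image_critical_iff[of x] by blast
  then show ?thesis unfolding structure_group_def by (rule generate.incl)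
qed

lemma asymptotically_equivalent_refl: "asymptotically_equivalent G w w"
  unfolding asymptotically_equivalent_def
  by (intro exI[of _ "\<lambda>_. id"]) (auto simp: id_in_G intro: finite_subset[of _ "{id}"])

lemma asymptotically_equivalent_trans:
  assumes "asymptotically_equivalent G u v" "asymptotically_equivalent G v w"
  shows "asymptotically_equivalent G u w"
proof -
  obtain g h :: "nat \<Rightarrow> 'x list \<Rightarrow> 'x list" where
    g: "\<forall>k\<ge>1. g k \<in> G" "finite (g ` {1..})" "\<forall>k\<ge>1. g k (word_end u k) = word_end v k" and
    h: "\<forall>k\<ge>1. h k \<in> G" "finite (h ` {1..})" "\<forall>k\<ge>1. h k (word_end v k) = word_end w k"
    using assms unfolding asymptotically_equivalent_def by metis
  have "(\<lambda>k. h k \<circ> g k) ` {1..} \<subseteq> (\<lambda>(a, b). a \<circ> b) ` (h ` {1..} \<times> g ` {1..})"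
    by auto
  then have "finite ((\<lambda>k. h k \<circ> g k) ` {1..})"
    using g(2) h(2) by (meson finite_SigmaI finite_imageI finite_subset)
  then show ?thesis
    unfolding asymptotically_equivalent_def using g h comp_in_G
    by (intro exI[of _ "\<lambda>k. h k \<circ> g k"]) auto
qed

text \<open>Applied to the end of length \<open>p\<close> of an address of \<open>x\<close>, and started in the state belonging to
  that length, the automaton stays on the path that spells the address. It runs through the period
  as often as \<open>p\<close> requires, permutes the letters taken from \<open>S\<^sub>n, \<dots>, S\<^sub>1\<close> cyclically, and is
  trivial afterwards. Since the digit sets of the periodic part are singletons, the outcome is the
  end of one and the same infinite word for all \<open>p\<close>.\<close>

lemma fiber_gen_rotates:
  assumes x: "x \<in> topspace K" and pres: "fiber_presentation \<pi> x z Ss" and w: "\<pi> w = x"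
  defines "state \<equiv> \<lambda>p. if p < length Ss then p
      else length Ss + (p - length Ss) mod length z"
  shows "fiber_gen z Ss (state p) (word_end w p @ t) =
    word_end (\<lambda>m. cyclic_perm (digits ((s ^^ m) x)) (w m)) p @ t"
proof (induction p)
  case 0
  have "state 0 = 0" using pres by (simp add: state_def fiber_presentation_def)
  then show ?case by simp
next
  case (Suc p)
  let ?n = "length Ss" and ?k = "length z"
  let ?rot = "\<lambda>m. cyclic_perm (digits ((s ^^ m) x)) (w m)"
  note digits = fiber_presentation_digits[OF x pres]
  have ne: "Ss \<noteq> []" "z \<noteq> []" and turn: "letter z ?k \<notin> letter Ss ?n"
    using pres by (auto simp: fiber_presentation_def)
  have w_digit: "w m \<in> digits ((s ^^ m) x)" for m using digit_pi[of w m] w by simp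
  have "fiber_gen z Ss (state (Suc p)) (w p # word_end w p @ t) =
      ?rot p # fiber_gen z Ss (state p) (word_end w p @ t)"
  proof (cases "p < ?n")
    case True
    have "w p \<in> letter Ss (Suc p)" "cyclic_perm (letter Ss (Suc p)) (w p) = ?rot p"
      using digits(1)[OF True] w_digit by simp_all
    moreover have "state p = p" using True by (simp add: state_def)
    moreover have "state (Suc p) = Suc p"
      using True by (cases "Suc p = ?n") (simp_all add: state_def)
    moreover have "?n - Suc 0 = p" if "Suc p = ?n" using that by simp
    ultimately show ?thesis
      using True fiber_gen_turn[OF ne(1), of z] by (cases "Suc p = ?n") (auto simp: fiber_gen_pre)
  next
    case False
    define i where "i = p - ?n"
    have p: "p = ?n + i" using False by (simp add: i_def)
    have wp: "w p = letter z (Suc (i mod ?k))"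
      using digits(2)[of i] w_digit[of p] by (simp add: p periodic_word_def)
    have rot: "?rot p = w p"
      using digits(2)[of i] by (simp add: p cyclic_perm_singleton)
    have state_p: "state p = ?n + i mod ?k" by (simp add: p state_def)
    have state_Suc: "state (Suc p) = ?n + Suc i mod ?k" by (simp add: p state_def Suc_diff_le)
    show ?thesis
    proof (cases "Suc (i mod ?k) = ?k")
      case True
      then have "state (Suc p) = ?n" "state p = ?n + ?k - 1"
        using state_p state_Suc by (simp_all add: mod_Suc)
      then show ?thesis
        using rot turn fiber_gen_turn[OF ne(1), of z "w p"] by (simp add: wp True)
    next
      case False
      then have "state (Suc p) = Suc (state p)" "state p = ?n + i mod ?k"
        using state_p state_Suc by (simp_all add: mod_Suc)
      then show ?thesis
        using rot fiber_gen_period[of Ss "state (Suc p)" z "w p"] by (simp add: wp Suc_diff_le)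
    qed
  qed
  then show ?case using Suc.IH by (simp add: word_end_Suc)
qed

text \<open>Rotating only the letters from position \<open>m\<close> on is the work of the generators that belong to
  the point \<open>(s ^^ m) x\<close>, which is critical itself as soon as it has two digits. Varying \<open>m\<close> makes
  it possible to treat the letters of an address one after the other.\<close>

definition rotate_from :: "nat \<Rightarrow> 'k \<Rightarrow> (nat \<Rightarrow> 'x) \<Rightarrow> nat \<Rightarrow> 'x" where
  "rotate_from m x w = (\<lambda>i. if i < m then w i else cyclic_perm (digits ((s ^^ i) x)) (w i))"

lemma pi_rotate_from:
  assumes x: "x \<in> topspace K" "\<pi> w = x"
  shows "\<pi> (rotate_from m x w) = x"
  using x(2) unfolding pi_eq_iff[OF x(1)] by (simp add: rotate_from_def cyclic_perm_in)

lemma asymptotically_equivalent_rotate_from: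
  assumes x: "x \<in> topspace K" "\<pi> w = x" and m: "2 \<le> card (digits ((s ^^ m) x))"
  shows "asymptotically_equivalent G w (rotate_from m x w)"
proof -
  let ?y = "(s ^^ m) x" and ?r = "rotate_from m x w" and ?v = "(shift ^^ m) w"
  have y: "?y \<in> topspace K" by (rule orbit_in[OF x(1)])
  obtain z Ss where pres: "fiber_presentation \<pi> ?y z Ss"
    using fiber_presentation_exists[OF y m] by blast
  let ?n = "length Ss" and ?k = "length z"
  have pos: "0 < ?n" "0 < ?k" using pres by (auto simp: fiber_presentation_def)
  define state where "state = (\<lambda>p. if p < ?n then p else ?n + (p - ?n) mod ?k)"
  define g where "g p = (if p \<le> m then id else fiber_gen z Ss (state (p - m)))" for p
  have v: "\<pi> ?v = ?y" using x(2) by (auto simp: orbit_pi)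
  have r: "(shift ^^ m) ?r = (\<lambda>i. cyclic_perm (digits ((s ^^ i) ?y)) (?v i))"
    by (simp add: rotate_from_def shift_funpow flip: orbit_add)
  have state_bounds: "state p \<in> {1..?n + ?k - 1}" if "0 < p" for p
  proof -
    have "(p - ?n) mod ?k < ?k" using pos by simp
    moreover have "state p = p \<and> p < ?n \<or> state p = ?n + (p - ?n) mod ?k"
      by (simp add: state_def)
    ultimately show ?thesis
      unfolding atLeastAtMost_iff using that pos by linarith
  qed
  have "g p \<in> G" for p
    using state_bounds[of "p - m"] fiber_gen_in_G[OF y m pres] id_in_G by (simp add: g_def)
  moreover have "finite (g ` {1..})"
  proof (rule finite_subset)
    show "g ` {1..} \<subseteq> insert id (fiber_gen z Ss ` {1..?n + ?k - 1})"
      using state_bounds by (auto simp: g_def)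
  qed simp
  moreover have "g p (word_end w p) = word_end ?r p" for p
  proof (cases "p \<le> m")
    case True
    have "word_end ?r p = word_end w p"
      by (rule word_end_cong) (use True in \<open>simp add: rotate_from_def\<close>)
    then show ?thesis using True by (simp add: g_def)
  next
    case False
    then obtain q where p: "p = m + q" by (metis le_iff_add nat_le_linear)
    have "word_end ?r m = word_end w m"
      by (rule word_end_cong) (simp add: rotate_from_def)
    moreover have "fiber_gen z Ss (state q) (word_end ?v q @ word_end w m) =
        word_end ((shift ^^ m) ?r) q @ word_end w m"
      unfolding r state_def by (rule fiber_gen_rotates[OF y pres v])
    ultimately show ?thesis
      using False by (simp add: p g_def word_end_add)
  qed
  ultimately show ?thesis unfolding asymptotically_equivalent_def by blast
qed

text \<open>Two addresses of the same point are matched from the right: a power of the rotation starting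
  at position \<open>m\<close> corrects the letter at \<open>m\<close> without disturbing those before it, and the
  letters after it remain free to be corrected later.\<close>

lemma asymptotically_equivalent_if_pi_eq:
  assumes "\<pi> u = \<pi> w"
  shows "asymptotically_equivalent G u w"
proof -
  define x where "x = \<pi> w"
  have x: "x \<in> topspace K" by (simp add: x_def pi_in)
  have digit: "v m \<in> digits ((s ^^ m) x)" if "\<pi> v = x" for v m
    using digit_pi[of v m] that by simp
  have w: "\<pi> w = x" by (simp add: x_def)
  have step: "\<exists>v'. asymptotically_equivalent G v v' \<and> \<pi> v' = x \<and>
      (\<forall>i<m. v' i = v i) \<and> v' m = w m" if v: "\<pi> v = x" for v m
  proof (cases "2 \<le> card (digits ((s ^^ m) x))")
    case True
    let ?c = "cyclic_perm (digits ((s ^^ m) x))"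
    have rot: "\<exists>v'. asymptotically_equivalent G v v' \<and> \<pi> v' = x \<and>
        (\<forall>i<m. v' i = v i) \<and> v' m = (?c ^^ e) (v m)" for e
    proof (induction e)
      case 0
      then show ?case using v asymptotically_equivalent_refl by auto
    next
      case (Suc e)
      then obtain v' where v': "asymptotically_equivalent G v v'" "\<pi> v' = x"
        "\<forall>i<m. v' i = v i" "v' m = (?c ^^ e) (v m)" by blast
      have "asymptotically_equivalent G v (rotate_from m x v')"
        using v' asymptotically_equivalent_trans
          asymptotically_equivalent_rotate_from[OF x v'(2) True] by blast
      moreover have "\<pi> (rotate_from m x v') = x"
        by (rule pi_rotate_from[OF x v'(2)])
      moreover have "(\<forall>i<m. rotate_from m x v' i = v i) \<and>
          rotate_from m x v' m = (?c ^^ Suc e) (v m)"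
        using v'(3,4) by (simp add: rotate_from_def)
      ultimately show ?case by blast
    qed
    obtain e where "(?c ^^ e) (v m) = w m"
      using cyclic_perm_transitive[OF _ digit[OF v] digit[OF w]] by auto
    then show ?thesis using rot[of e] by metis
  next
    case False
    then have "v m = w m"
      using digits_singleton[OF orbit_in[OF x] False digit[OF v]] digit[OF w, of m] by simp
    then show ?thesis using v asymptotically_equivalent_refl by metis
  qed
  have match: "\<exists>v. asymptotically_equivalent G u v \<and> \<pi> v = x \<and> (\<forall>i<m. v i = w i)" for m
  proof (induction m)
    case 0
    then show ?case using assms w asymptotically_equivalent_refl by auto
  next
    case (Suc m)
    then obtain v where v: "asymptotically_equivalent G u v" "\<pi> v = x" "\<forall>i<m. v i = w i"
      by blast
    then obtain v' where "asymptotically_equivalent G v v'" "\<pi> v' = x"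
      "\<forall>i<m. v' i = v i" "v' m = w m" using step by metis
    then show ?case
      using v asymptotically_equivalent_trans by (metis less_Suc_eq)
  qed
  obtain N where N: "\<forall>m\<ge>N. \<not> 2 \<le> card (digits ((s ^^ m) x))"
    using eventually_single_digit[OF x] ..
  obtain v where v: "asymptotically_equivalent G u v" "\<pi> v = x" "\<forall>i<N. v i = w i"
    using match by blast
  have "v i = w i" for i
  proof (cases "i < N")
    case False
    then show ?thesis
      using digits_singleton[OF orbit_in[OF x] _ digit[OF v(2)], of i] N digit[OF w, of i] by simp
  qed (use v in simp)
  then have "v = w" by blast
  then show ?thesis using v(1) by simp
qed

section \<open>Asymptotically equivalent words have the same image\<close>

text \<open>A generator \<open>g\<close> in state \<open>j\<close> moves the word \<open>v\<close> to another word, but the point whose address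
  is \<open>v\<close> preceded by an address of \<open>(s ^^ j) x\<close> also has an address ending in \<open>g v\<close>, because each
  letter is replaced by a digit of the same point of the orbit of \<open>x\<close> until the automaton becomes
  trivial. Hence the cells belonging to \<open>v\<close> and \<open>g v\<close> always intersect.\<close>

lemma pi_fiber_gen:
  assumes x: "x \<in> topspace K" and pres: "fiber_presentation \<pi> x z Ss"
  shows "j \<le> length Ss + length z - 1 \<Longrightarrow> \<pi> a = (s ^^ j) x \<Longrightarrow> \<pi> b = (s ^^ j) x \<Longrightarrow>
    \<pi> (word_append a v) = \<pi> (word_append b (fiber_gen z Ss j v))"
proof (induction v arbitrary: j a b)
  case Nil
  then show ?case by simp
next
  case (Cons y v)
  let ?n = "length Ss" and ?k = "length z"
  note digits = fiber_presentation_digits[OF x pres]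
  have ne: "Ss \<noteq> []" "z \<noteq> []" using pres by (auto simp: fiber_presentation_def)
  then have pos: "0 < ?n" "0 < ?k" by simp_all
  \<comment> \<open>A letter that fits the orbit takes both words one step back along it.\<close>
  have follow: "\<pi> (word_append a (y # v)) = \<pi> (word_append b (fiber_gen z Ss j (y # v)))"
    if "i \<le> ?n + ?k - 1" "fiber_gen z Ss j (y # v) = y' # fiber_gen z Ss i v" "(s ^^ j) x = s ((s ^^ i) x)"
      "y \<in> digits ((s ^^ i) x)" "y' \<in> digits ((s ^^ i) x)" for i y'
  proof -
    have "\<pi> (word_append a [y]) = (s ^^ i) x" "\<pi> (word_append b [y']) = (s ^^ i) x"
      using Cons.prems(2,3) that(3-5) pi_append_digit[OF orbit_in[OF x]] by simp_all
    then have "\<pi> (word_append (word_append a [y]) v) =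
        \<pi> (word_append (word_append b [y']) (fiber_gen z Ss i v))"
      by (rule Cons.IH[OF that(1)])
    then show ?thesis unfolding that(2) by (metis word_append_Cons)
  qed
  have stay: "\<pi> (word_append a (y # v)) = \<pi> (word_append b (y # v))"
    by (rule pi_append_cong) (simp add: Cons.prems)
  have tail: "letter z (Suc i) \<in> digits ((s ^^ (?n + i)) x)" if "i < ?k" for i
    using digits(2)[of i] that by (simp add: periodic_word_def)
  consider "j = 0" | "0 < j" "j < ?n" | "j = ?n" | "?n < j" by linarith
  then show ?case
  proof cases
    case 1
    then show ?thesis using stay by simp
  next
    case 2
    then obtain i where i: "j = Suc i" by (metis gr0_conv_Suc)
    show ?thesis
    proof (cases "y \<in> letter Ss j")
      case True
      then have "y \<in> digits ((s ^^ i) x)" using digits(1)[of i] 2 i by simp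
      moreover from this have "cyclic_perm (letter Ss j) y \<in> digits ((s ^^ i) x)"
        using digits(1)[of i] 2 i by (simp add: cyclic_perm_in)
      ultimately show ?thesis
        using True 2 i by (intro follow[of i "cyclic_perm (letter Ss j) y"]) (simp_all add: fiber_gen_pre)
    next
      case False
      then show ?thesis using stay 2 by (simp add: fiber_gen_pre)
    qed
  next
    case 3
    obtain i where i: "?n = Suc i" using pos by (metis gr0_conv_Suc)
    obtain l where l: "?k = Suc l" using pos by (metis gr0_conv_Suc)
    consider "y \<in> letter Ss ?n" | "y \<notin> letter Ss ?n" "y = letter z ?k"
      | "y \<notin> letter Ss ?n" "y \<noteq> letter z ?k" by blast
    then show ?thesis
    proof cases
      case 1
      then have "y \<in> digits ((s ^^ i) x)" using digits(1)[of i] i by simp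
      moreover from this have "cyclic_perm (letter Ss ?n) y \<in> digits ((s ^^ i) x)"
        using digits(1)[of i] i by (simp add: cyclic_perm_in)
      ultimately show ?thesis
        using 1 3 i fiber_gen_turn[OF ne(1), of z y v]
        by (intro follow[of i "cyclic_perm (letter Ss ?n) y"]) simp_all
    next
      case 2
      have "(s ^^ j) x = s ((s ^^ (?n + l)) x)" using digits(3) 3 l by simp
      moreover have "y \<in> digits ((s ^^ (?n + l)) x)" using tail[of l] l 2 by simp
      ultimately show ?thesis
        using 2 3 l fiber_gen_turn[OF ne(1), of z y v] by (intro follow[of "?n + l" y]) simp_all
    next
      case other: 3
      then show ?thesis using stay 3 fiber_gen_turn[OF ne(1), of z y v] by simp
    qed
  next
    case 4
    then obtain i where i: "j = Suc (?n + i)" by (metis less_iff_Suc_add)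
    show ?thesis
    proof (cases "y = letter z (j - ?n)")
      case True
      then have "y \<in> digits ((s ^^ (?n + i)) x)"
        using tail[of i] Cons.prems(1) i pos by (simp add: Suc_diff_le)
      then show ?thesis
        using True 4 i Cons.prems(1)
        by (intro follow[of "?n + i" y]) (simp_all add: fiber_gen_period)
    next
      case False
      then show ?thesis using stay 4 by (simp add: fiber_gen_period)
    qed
  qed
qed

text \<open>The second conjunct says that the cells of \<open>v\<close> and \<open>g v\<close> are uniformly close to each other
  once \<open>v\<close> is long. Unlike the intersection of these cells, this property passes from generators
  to all members of the group.\<close>

definition displacement_vanishes :: "('k \<Rightarrow> 'k \<Rightarrow> real) \<Rightarrow> ('x list \<Rightarrow> 'x list) \<Rightarrow> bool" where
  "displacement_vanishes d g \<longleftrightarrow>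
     (\<forall>v. length (g v) = length v) \<and>
     (\<forall>\<epsilon>>0. \<exists>N. \<forall>v a b. N \<le> length v \<longrightarrow>
        d (\<pi> (word_append a v)) (\<pi> (word_append b (g v))) < \<epsilon>)"

lemma displacement_vanishesI:
  assumes "\<And>v. length (g v) = length v"
    and "\<And>\<epsilon>. \<epsilon> > 0 \<Longrightarrow> \<exists>N. \<forall>v a b. N \<le> length v \<longrightarrow>
      d (\<pi> (word_append a v)) (\<pi> (word_append b (g v))) < \<epsilon>"
  shows "displacement_vanishes d g"
  using assms unfolding displacement_vanishes_def by blast

lemma displacement_vanishes_length: "displacement_vanishes d g \<Longrightarrow> length (g v) = length v"
  by (simp add: displacement_vanishes_def)

lemma displacement_vanishesE:
  assumes "displacement_vanishes d g" "\<epsilon> > 0"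
  obtains N where "\<And>v a b. N \<le> length v \<Longrightarrow>
    d (\<pi> (word_append a v)) (\<pi> (word_append b (g v))) < \<epsilon>"
proof -
  have "\<exists>N. \<forall>v a b. N \<le> length v \<longrightarrow> d (\<pi> (word_append a v)) (\<pi> (word_append b (g v))) < \<epsilon>"
    using assms unfolding displacement_vanishes_def by simp
  then obtain N where "\<forall>v a b. N \<le> length v \<longrightarrow>
      d (\<pi> (word_append a v)) (\<pi> (word_append b (g v))) < \<epsilon>" ..
  then show thesis by (intro that[of N]) simp
qed

context
  fixes M :: "'k set" and d :: "'k \<Rightarrow> 'k \<Rightarrow> real"
  assumes metric: "Metric_space M d" and K_def: "K = Metric_space.mtopology M d"
begin

interpretation Metric_space M d by (rule metric)

lemma pi_in_M: "\<pi> w \<in> M"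
  using pi_in K_def by simp

lemma displacement_vanishes_id: "displacement_vanishes d id"
proof (rule displacement_vanishesI)
  fix \<epsilon> :: real assume "\<epsilon> > 0"
  then obtain N where N: "\<forall>u w. (\<forall>m<N. u m = w m) \<longrightarrow> d (\<pi> u) (\<pi> w) < \<epsilon>"
    using uniformly_continuous_on_words[OF continuous_pi[unfolded K_def]] by meson
  have "d (\<pi> (word_append a v)) (\<pi> (word_append b (id v))) < \<epsilon>" if "N \<le> length v" for v a b
  proof -
    have "\<forall>m<N. word_append a v m = word_append b (id v) m"
      using that by (simp add: word_append_def)
    then show ?thesis using N by blast
  qed
  then show "\<exists>N. \<forall>v a b. N \<le> length v \<longrightarrow>
      d (\<pi> (word_append a v)) (\<pi> (word_append b (id v))) < \<epsilon>" by blast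
qed simp

lemma displacement_vanishes_comp:
  assumes g: "displacement_vanishes d g" and h: "displacement_vanishes d h"
  shows "displacement_vanishes d (g \<circ> h)"
proof (rule displacement_vanishesI)
  fix v show "length ((g \<circ> h) v) = length v"
    using g h by (simp add: displacement_vanishes_length)
next
  fix \<epsilon> :: real assume "\<epsilon> > 0"
  then have "\<epsilon> / 2 > 0" by simp
  obtain N1 where N1: "\<And>v a b. N1 \<le> length v \<Longrightarrow>
      d (\<pi> (word_append a v)) (\<pi> (word_append b (g v))) < \<epsilon> / 2"
    using displacement_vanishesE[OF g \<open>\<epsilon> / 2 > 0\<close>] by blast
  obtain N2 where N2: "\<And>v a b. N2 \<le> length v \<Longrightarrow>
      d (\<pi> (word_append a v)) (\<pi> (word_append b (h v))) < \<epsilon> / 2"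
    using displacement_vanishesE[OF h \<open>\<epsilon> / 2 > 0\<close>] by blast
  have "d (\<pi> (word_append a v)) (\<pi> (word_append b ((g \<circ> h) v))) < \<epsilon>"
    if "max N1 N2 \<le> length v" for v a b
  proof -
    have "d (\<pi> (word_append a v)) (\<pi> (word_append a (h v))) < \<epsilon> / 2"
      using N2 that by simp
    moreover have "d (\<pi> (word_append a (h v))) (\<pi> (word_append b (g (h v)))) < \<epsilon> / 2"
      using N1 that h by (simp add: displacement_vanishes_length)
    moreover have "d (\<pi> (word_append a v)) (\<pi> (word_append b (g (h v)))) \<le>
        d (\<pi> (word_append a v)) (\<pi> (word_append a (h v))) +
        d (\<pi> (word_append a (h v))) (\<pi> (word_append b (g (h v))))"
      by (intro triangle pi_in_M)
    ultimately show ?thesis by simp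
  qed
  then show "\<exists>N. \<forall>v a b. N \<le> length v \<longrightarrow>
      d (\<pi> (word_append a v)) (\<pi> (word_append b ((g \<circ> h) v))) < \<epsilon>" by blast
qed

lemma displacement_vanishes_inv:
  assumes g: "displacement_vanishes d g" and "bij g"
  shows "displacement_vanishes d (inv_into UNIV g)"
proof (rule displacement_vanishesI)
  have g_inv: "g (inv_into UNIV g v) = v" for v
    using \<open>bij g\<close> by (simp add: bij_is_surj surj_f_inv_f)
  show len: "length (inv_into UNIV g v) = length v" for v
    using displacement_vanishes_length[OF g, of "inv_into UNIV g v"] g_inv by simp
  fix \<epsilon> :: real assume "\<epsilon> > 0"
  then obtain N where N: "\<And>v a b. N \<le> length v \<Longrightarrow>
      d (\<pi> (word_append a v)) (\<pi> (word_append b (g v))) < \<epsilon>"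
    using displacement_vanishesE[OF g] by blast
  have "d (\<pi> (word_append a v)) (\<pi> (word_append b (inv_into UNIV g v))) < \<epsilon>"
    if "N \<le> length v" for v a b
    using N[of "inv_into UNIV g v" b a] that by (simp add: len g_inv commute)
  then show "\<exists>N. \<forall>v a b. N \<le> length v \<longrightarrow>
      d (\<pi> (word_append a v)) (\<pi> (word_append b (inv_into UNIV g v))) < \<epsilon>" by blast
qed

lemma displacement_vanishes_generator:
  assumes "g \<in> structure_generators K F \<pi>"
  shows "tree_automorphism g \<and> displacement_vanishes d g"
proof -
  obtain x z Ss j where g: "g = fiber_gen z Ss j" and "x \<in> \<pi> ` critical_set K F \<pi>"
    and pres: "fiber_presentation \<pi> x z Ss" and j: "j \<le> length Ss + length z - 1"
    using assms unfolding structure_generators_def by blast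
  then have x: "x \<in> topspace K" by (simp add: image_critical_iff)
  have "Ss \<noteq> []" using pres by (simp add: fiber_presentation_def)
  then have A: "self_similar_maps (range (fiber_gen z Ss))" "g \<in> range (fiber_gen z Ss)"
    by (simp_all add: self_similar_maps_fiber_gen g)
  note len = self_similar_maps_length[OF A]
  obtain c where c: "\<pi> c = (s ^^ j) x" using pi_onto[OF orbit_in[OF x]] by metis
  have meet: "\<pi> (word_append c v) = \<pi> (word_append c (g v))" for v
    unfolding g by (rule pi_fiber_gen[OF x pres j c c])
  have "displacement_vanishes d g"
  proof (rule displacement_vanishesI)
    fix \<epsilon> :: real assume "\<epsilon> > 0"
    then have "\<epsilon> / 2 > 0" by simp
    obtain N where N: "\<And>v a b. N \<le> length v \<Longrightarrow>
        d (\<pi> (word_append a v)) (\<pi> (word_append b (id v))) < \<epsilon> / 2"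
      using displacement_vanishesE[OF displacement_vanishes_id \<open>\<epsilon> / 2 > 0\<close>] by blast
    have "d (\<pi> (word_append a v)) (\<pi> (word_append b (g v))) < \<epsilon>" if "N \<le> length v" for v a b
    proof -
      have "d (\<pi> (word_append a v)) (\<pi> (word_append c v)) < \<epsilon> / 2"
        using N[of v a c] that by simp
      moreover have "d (\<pi> (word_append c v)) (\<pi> (word_append b (g v))) < \<epsilon> / 2"
        using N[of "g v" c b] that by (simp add: meet[of v] len)
      moreover have "d (\<pi> (word_append a v)) (\<pi> (word_append b (g v))) \<le>
          d (\<pi> (word_append a v)) (\<pi> (word_append c v)) +
          d (\<pi> (word_append c v)) (\<pi> (word_append b (g v)))"
        by (intro triangle pi_in_M)
      ultimately show ?thesis by simp
    qed
    then show "\<exists>N. \<forall>v a b. N \<le> length v \<longrightarrow>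
        d (\<pi> (word_append a v)) (\<pi> (word_append b (g v))) < \<epsilon>" by blast
  qed (rule len)
  then show ?thesis using self_similar_maps_tree_automorphism[OF A] by simp
qed

lemma displacement_vanishes_G:
  assumes "g \<in> G"
  shows "displacement_vanishes d g"
  using assms unfolding structure_group_def
proof (induction rule: generate.induct)
  case one
  then show ?case using displacement_vanishes_id by (simp add: Aut_words_def id_def)
next
  case (incl g)
  then show ?case using displacement_vanishes_generator by blast
next
  case (inv g)
  then have g: "tree_automorphism g" "displacement_vanishes d g"
    using displacement_vanishes_generator by simp_all
  moreover from this have "bij g" by (simp add: tree_automorphism_def)
  ultimately show ?case
    using displacement_vanishes_inv by (simp add: m_inv_Aut_words)
next
  case (eng g h)
  then show ?case using displacement_vanishes_comp[of g h] by (simp add: Aut_words_def o_def)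
qed

text \<open>The ends of length \<open>k\<close> of \<open>u\<close> and \<open>w\<close> are related by an element of the group, so their cells
  become arbitrarily close as \<open>k\<close> grows. These cells contain \<open>\<pi> u\<close> and \<open>\<pi> w\<close>.\<close>

lemma pi_eq_if_asymptotically_equivalent_metric:
  assumes "asymptotically_equivalent G u w"
  shows "\<pi> u = \<pi> w"
proof -
  obtain g where g: "\<forall>k\<ge>1. g k \<in> G" "finite (g ` {1..})"
    "\<forall>k\<ge>1. g k (word_end u k) = word_end w k"
    using assms unfolding asymptotically_equivalent_def by blast
  have small: "d (\<pi> u) (\<pi> w) < \<epsilon>" if "\<epsilon> > 0" for \<epsilon>
  proof -
    have "\<forall>h\<in>g ` {1..}. \<exists>N. \<forall>v a b. N \<le> length v \<longrightarrow>
        d (\<pi> (word_append a v)) (\<pi> (word_append b (h v))) < \<epsilon>"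
      using g(1) displacement_vanishes_G that unfolding displacement_vanishes_def by auto
    from bchoice[OF this] obtain N where N: "\<forall>h\<in>g ` {1..}. \<forall>v a b. N h \<le> length v \<longrightarrow>
        d (\<pi> (word_append a v)) (\<pi> (word_append b (h v))) < \<epsilon>" ..
    \<comment> \<open>Only finitely many elements occur, so a single length serves all of them.\<close>
    define k where "k = Suc (Max (N ` g ` {1..}))"
    have gk: "g k \<in> g ` {1..}" by (simp add: k_def)
    then have "N (g k) \<le> Max (N ` g ` {1..})" using g(2) by (intro Max_ge) auto
    then have "N (g k) \<le> length (word_end u k)" by (simp add: k_def)
    then have "d (\<pi> (word_append ((shift ^^ k) u) (word_end u k)))
        (\<pi> (word_append ((shift ^^ k) w) (g k (word_end u k)))) < \<epsilon>"
      using N gk by blast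
    moreover have "g k (word_end u k) = word_end w k" using g(3) by (simp add: k_def)
    ultimately show ?thesis by (simp add: word_append_word_end)
  qed
  have "d (\<pi> u) (\<pi> w) \<le> 0"
    by (rule field_le_epsilon) (simp add: less_imp_le[OF small])
  then show ?thesis
    using pi_in_M by (metis mdist_pos_less not_le)
qed

end

lemma asymptotically_equivalent_iff: "asymptotically_equivalent G u w \<longleftrightarrow> \<pi> u = \<pi> w"
proof
  obtain M d where "Metric_space M d" "K = Metric_space.mtopology M d"
    using metrizable unfolding metrizable_space_def by blast
  then show "asymptotically_equivalent G u w \<Longrightarrow> \<pi> u = \<pi> w"
    by (rule pi_eq_if_asymptotically_equivalent_metric)
qed (rule asymptotically_equivalent_if_pi_eq)

end


section \<open>The limit space\<close>

lemma quotient_map_limit_map: "quotient_map word_topology (limit_space G) (limit_map G)"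
  unfolding limit_space_def limit_map_def by (rule quotient_map_quotient_topology)

theorem theorem5p8:
  fixes K :: "'k topology"
    and F :: "'x::{finite,linorder} \<Rightarrow> 'k \<Rightarrow> 'k"
    and \<pi> :: "(nat \<Rightarrow> 'x) \<Rightarrow> 'k"
  assumes "self_similar_structure K F"
    and "associated_surjection K F \<pi>"
    and "post_critically_finite K F \<pi>"
    and "induced_shift_well_defined K \<pi>"
  shows "\<exists>F' :: 'x \<Rightarrow> (nat \<Rightarrow> 'x) set \<Rightarrow> (nat \<Rightarrow> 'x) set.
    self_similar_structure (limit_space (structure_group K F \<pi>)) F' \<and>
    associated_surjection (limit_space (structure_group K F \<pi>)) F'
      (limit_map (structure_group K F \<pi>)) \<and>
    isomorphic_structures (limit_space (structure_group K F \<pi>)) F' K F"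
proof -
  obtain s where "s \<circ> \<pi> = \<pi> \<circ> shift"
    using assms(4) unfolding induced_shift_well_defined_def by blast
  then have "s (\<pi> w) = \<pi> (shift w)" for w by (metis comp_apply)
  then interpret shift_invariant_structure K F \<pi> s
    using assms by unfold_locales (auto simp: self_similar_structure_def)
  let ?J = "limit_space G" and ?p = "limit_map G"
  have p_eq_iff: "?p u = ?p w \<longleftrightarrow> \<pi> u = \<pi> w" for u w
    by (auto simp: limit_map_def asymptotic_relation_def asymptotically_equivalent_iff)
  have p: "quotient_map word_topology ?J ?p" by (rule quotient_map_limit_map)
  have p_onto: "topspace ?J = range ?p"
    using quotient_imp_surjective_map[OF p] by simp
  have q: "quotient_map word_topology K \<pi>"
    using continuous_pi compact_word_topology metrizable_imp_Hausdorff_space[OF metrizable] range_pi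
    by (intro continuous_imp_quotient_map) simp_all
  \<comment> \<open>Both the limit space and \<open>K\<close> are quotients of the space of words by the same relation.\<close>
  define h where "h c = \<pi> (inv_into UNIV ?p c)" for c
  have h_p: "h (?p w) = \<pi> w" for w
  proof -
    have "?p (inv_into UNIV ?p (?p w)) = ?p w"
      by (rule f_inv_into_f[of _ ?p UNIV]) (rule rangeI)
    then show ?thesis by (simp add: h_def p_eq_iff)
  qed
  then have "h \<circ> ?p = \<pi>" by auto
  then have "continuous_map ?J K h"
    by (intro continuous_compose_quotient_map[OF p]) (simp only: continuous_pi)
  then have "quotient_map ?J K h"
    by (rule quotient_map_from_composition[OF quotient_imp_continuous_map[OF p]])
      (simp only: \<open>h \<circ> ?p = \<pi>\<close> q)
  moreover have "inj_on h (topspace ?J)"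
    by (auto simp: inj_on_def p_onto h_p p_eq_iff)
  ultimately have h: "homeomorphic_map ?J K h"
    by (simp add: homeomorphic_map_def)
  then obtain h' where h': "homeomorphic_maps ?J K h h'"
    using homeomorphic_map_maps by blast
  have h'_pi: "h' (\<pi> w) = ?p w" for w
    using h' p_onto h_p unfolding homeomorphic_maps_def by (metis rangeI)
  define F' where "F' i = h' \<circ> F i \<circ> h" for i
  have F: "continuous_map K K (F i)" "inj_on (F i) (topspace K)" for i
    using assms(1) by (auto simp: self_similar_structure_def)
  have F'_p: "F' i (?p w) = ?p (word_append w [i])" for i w
    by (simp add: F'_def h_p F_pi h'_pi)
  have surj: "associated_surjection ?J F' ?p"
    using quotient_imp_continuous_map[OF p] p_onto F'_p by (simp add: associated_surjection_def)
  have "continuous_map ?J ?J (F' i)" for i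
    unfolding F'_def using h' F(1)[of i] unfolding homeomorphic_maps_def
    by (meson continuous_map_compose)
  moreover have "inj_on (F' i) (topspace ?J)" for i
  proof (rule inj_onI)
    fix c c' assume c: "c \<in> topspace ?J" "c' \<in> topspace ?J" "F' i c = F' i c'"
    obtain u where u: "c = ?p u" using c(1) unfolding p_onto by (rule rangeE)
    obtain w where w: "c' = ?p w" using c(2) unfolding p_onto by (rule rangeE)
    have "F i (\<pi> u) = F i (\<pi> w)" using c(3) by (simp add: u w F'_p p_eq_iff F_pi)
    then have "\<pi> u = \<pi> w" by (rule inj_onD[OF F(2) _ pi_in pi_in])
    then show "c = c'" by (simp add: u w p_eq_iff)
  qed
  moreover have "?J homeomorphic_space K"
    using h homeomorphic_map_imp_homeomorphic_space by blast
  then have "compact_space ?J" "metrizable_space ?J"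
    using assms(1) homeomorphic_compact_space homeomorphic_metrizable_space
    by (auto simp: self_similar_structure_def)
  ultimately have "self_similar_structure ?J F'"
    using surj unfolding self_similar_structure_def by blast
  moreover have "isomorphic_structures ?J F' K F"
    unfolding isomorphic_structures_def
    by (intro exI[of _ ?p] exI[of _ \<pi>] exI[of _ id] exI[of _ h] conjI)
      (simp_all add: surj assms(2) h h_p)
  ultimately show ?thesis using surj by blast
qed

end
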